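(* Let $(h_j)_j\subset\mathcal{H}$ be a sequence and let $h\in\mathcal{H}$. If $(\mathcal{L}_{h_j})_j$ $H$-converges to $\mathcal{L}_h$ as $j\to\infty$, then for every $f\in X_0'$ the whole sequence $u_j=\mathcal{L}_{h_j}^{-1}f$ converges to $u=\mathcal{L}_h^{-1}f$ strongly in $X_0$ as $j\to\infty$.
   Context: Let $\Omega\subset\mathbb{R}^N$ be a bounded open smooth domain, let $1<p<\infty$ and $p'=p/(p-1)$. Let $k$ be a radial and positive function in $L^1(\mathbb{R}^N)$ (written $k(|z|)$, $z\in\mathbb{R}^N$) such that $\int_{\mathbb{R}^N\setminus B(0,\epsilon)}\frac{k(|z|)}{|z|^p}\,dz<\infty$ for every $\epsilon>0$, where $B(0,\epsilon)$ is the open ball of radius $\epsilon$ centred at $0$, and $k(|z|)\ge \frac{c_0}{|z|^{N+(s-1)p}}$ for all $z\in\mathbb{R}^N\setminus\{0\}$, where $c_0>0$ and $s\in(0,1)$ are given constants. Put $B(w,w)=\int_{\mathbb{R}^N}\int_{\mathbb{R}^N}k(|x'-x|)\frac{|w(x')-w(x)|^p}{|x'-x|^p}\,dx'dx$, $X=\{w\in L^p(\mathbb{R}^N): B(w,w)<\infty\}$ and $X_0=\{w\in X: w=0\text{ a.e. in }\mathbb{R}^N\setminus\Omega\}$, normed by $\|w\|_{X_0}=B(w,w)^{1/p}$ (equivalent on $X_0$ to $\|w\|_{L^p(\mathbb{R}^N)}+B(w,w)^{1/p}$). $X_0'$ is its dual and $\langle\cdot,\cdot\rangle$ the duality pairing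 between $X_0'$ and $X_0$. All functions are real-valued. Fix constants $0<h_{\min}<h_{\max}$; $\mathcal{H}$ is the set of $h\in L^\infty(\mathbb{R}^N\times\mathbb{R}^N)$ with $h(x',x)=h(x,x')\in[h_{\min},h_{\max}]$ for a.e. $(x',x)$. For $h\in\mathcal{H}$ and $u,v\in X_0$, $$B_h(u,v)=\int_{\mathbb{R}^N}\int_{\mathbb{R}^N}h(x',x)\,k(|x'-x|)\,\frac{|u(x')-u(x)|^{p-2}(u(x')-u(x))(v(x')-v(x))}{|x'-x|^p}\,dx'dx ,$$ and the operator $\mathcal{L}_h:X_0\to X_0'$ is defined by $\langle\mathcal{L}_hu,v\rangle=B_h(u,v)$. For every $f\in X_0'$ there is a unique $u\in X_0$ with $\mathcal{L}_hu=f$, i.e. $B_h(u,v)=\langle f,v\rangle$ for all $v\in X_0$; it is denoted $\mathcal{L}_h^{-1}f$. The nonlocal flux associated with $h$ (and $f$) is $$\Psi_h(x',x)=h(x',x)\,k(|x'-x|)^{1/p'}\,\frac{|u(x')-u(x)|^{p-2}(u(x')-u(x))}{|x'-x|^{p-1}},\qquad u=\mathcal{L}_h^{-1}f .$$ $H$-convergence: $(\mathcal{L}_{h_j})_j$ $H$-converges to $\mathcal{L}_h$ if for every $f\in X_0'$, as $j\to\infty$: (1) $\mathcal{L}_{h_j}^{-1}f\rightharpoonup\mathcal{L}_h^{-1}f$ weakly in $X_0$; and (2) $\Psi_{h_j}\rightharpoonup\Psi_h$ weakly in $L^{p'}(\mathbb{R}^N\times\mathbb{R}^N)$.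
   Formalization: The assumptions k in L^1(R^N) and k(|z|) ≥ c_0/|z|^{N+(s-1)p} for all z ≠ 0 contradict each other (the lower bound is not integrable at infinity); integrability of k is required only on every ball, which is weaker than the stated assumption. *)

theory Defs
  imports "HOL-Analysis.Analysis"
begin

section \<open>Smooth domains\<close>

primrec Ck_on :: "nat \<Rightarrow> 'a::euclidean_space set \<Rightarrow> ('a \<Rightarrow> real) \<Rightarrow> bool" where
  "Ck_on 0 U \<phi> \<longleftrightarrow> continuous_on U \<phi>"
| "Ck_on (Suc m) U \<phi> \<longleftrightarrow>
     \<phi> differentiable_on U \<and> (\<forall>b\<in>Basis. Ck_on m U (\<lambda>x. frechet_derivative \<phi> (at x) b))"

definition smooth_fun_on :: "'a::euclidean_space set \<Rightarrow> ('a \<Rightarrow> real) \<Rightarrow> bool" where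
  "smooth_fun_on U \<phi> \<longleftrightarrow> (\<forall>m. Ck_on m U \<phi>)"

text \<open>The boundary is described by local defining functions. As the derivative of \<open>\<phi>\<close> does not
  vanish on \<open>U\<close>, the set \<open>frontier \<Omega> \<inter> U\<close> is the level set \<open>\<phi> = 0\<close>, a smooth hypersurface, and
  \<open>\<Omega>\<close> lies locally on one side of it.\<close>

definition smooth_boundary :: "'a::euclidean_space set \<Rightarrow> bool" where
  "smooth_boundary \<Omega> \<longleftrightarrow>
     (\<forall>x\<^sub>0\<in>frontier \<Omega>. \<exists>U \<phi>. open U \<and> x\<^sub>0 \<in> U \<and> smooth_fun_on U \<phi> \<and>
        (\<forall>x\<in>U. frechet_derivative \<phi> (at x) \<noteq> (\<lambda>_. 0)) \<and>
        \<Omega> \<inter> U = {x \<in> U. \<phi> x < 0})"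

definition smooth_domain :: "'a::euclidean_space set \<Rightarrow> bool" where
  "smooth_domain \<Omega> \<longleftrightarrow> open \<Omega> \<and> connected \<Omega> \<and> \<Omega> \<noteq> {} \<and> smooth_boundary \<Omega>"

section \<open>Spaces of functions given by representatives\<close>

text \<open>Elements of \<open>L\<^sup>p\<close> and of \<open>X\<^sub>0\<close> are represented by Borel functions, and \<open>N\<close> below is a
  seminorm on representatives vanishing exactly on the functions that are zero almost everywhere.
  A functional bounded by \<open>N\<close> therefore takes equal values on functions that agree almost
  everywhere, so these functionals are those on the quotient; their values off \<open>V\<close> are
  irrelevant.\<close>

definition dual_space :: "('b \<Rightarrow> real) set \<Rightarrow> (('b \<Rightarrow> real) \<Rightarrow> real) \<Rightarrow> (('b \<Rightarrow> real) \<Rightarrow> real) set" where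
  "dual_space V N = {f.
     (\<forall>u\<in>V. \<forall>v\<in>V. f (\<lambda>x. u x + v x) = f u + f v) \<and>
     (\<forall>c. \<forall>u\<in>V. f (\<lambda>x. c * u x) = c * f u) \<and>
     (\<exists>C. \<forall>u\<in>V. \<bar>f u\<bar> \<le> C * N u)}"

definition weakly_converges ::
  "('b \<Rightarrow> real) set \<Rightarrow> (('b \<Rightarrow> real) \<Rightarrow> real) \<Rightarrow> (nat \<Rightarrow> 'b \<Rightarrow> real) \<Rightarrow> ('b \<Rightarrow> real) \<Rightarrow> bool" where
  "weakly_converges V N us u \<longleftrightarrow>
     (\<forall>j. us j \<in> V) \<and> u \<in> V \<and> (\<forall>f\<in>dual_space V N. (\<lambda>j. f (us j)) \<longlonglongrightarrow> f u)"

definition strongly_converges ::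
  "('b \<Rightarrow> real) set \<Rightarrow> (('b \<Rightarrow> real) \<Rightarrow> real) \<Rightarrow> (nat \<Rightarrow> 'b \<Rightarrow> real) \<Rightarrow> ('b \<Rightarrow> real) \<Rightarrow> bool" where
  "strongly_converges V N us u \<longleftrightarrow>
     (\<forall>j. us j \<in> V) \<and> u \<in> V \<and> (\<lambda>j. N (\<lambda>x. us j x - u x)) \<longlonglongrightarrow> 0"

definition Lp_space :: "real \<Rightarrow> 'b measure \<Rightarrow> ('b \<Rightarrow> real) set" where
  "Lp_space p M = {w \<in> borel_measurable M. integrable M (\<lambda>x. \<bar>w x\<bar> powr p)}"

definition Lp_norm :: "real \<Rightarrow> 'b measure \<Rightarrow> ('b \<Rightarrow> real) \<Rightarrow> real" where
  "Lp_norm p M w = (\<integral>x. \<bar>w x\<bar> powr p \<partial>M) powr (1 / p)"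

section \<open>The nonlocal operator\<close>

text \<open>The kernel is given by its radial profile \<open>k\<close>, that is, as \<open>\<lambda>z. k (norm z)\<close>; the pair
  \<open>(x', x)\<close> is the variable of all double integrals. On the diagonal, which is a null set, the
  quotients below are \<open>0\<close> because division by zero gives \<open>0\<close>.\<close>

definition energy :: "real \<Rightarrow> (real \<Rightarrow> real) \<Rightarrow> ('a::euclidean_space \<Rightarrow> real) \<Rightarrow> ennreal" where
  "energy p k w =
     (\<integral>\<^sup>+(x', x). ennreal (k (norm (x' - x)) * (\<bar>w x' - w x\<bar> powr p / norm (x' - x) powr p))
        \<partial>(lborel \<Otimes>\<^sub>M lborel))"

definition X_space :: "real \<Rightarrow> (real \<Rightarrow> real) \<Rightarrow> ('a::euclidean_space \<Rightarrow> real) set" where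
  "X_space p k = {w \<in> Lp_space p lborel. energy p k w < \<infinity>}"

definition X0_space :: "'a::euclidean_space set \<Rightarrow> real \<Rightarrow> (real \<Rightarrow> real) \<Rightarrow> ('a \<Rightarrow> real) set" where
  "X0_space \<Omega> p k = {w \<in> X_space p k. AE x in lborel. x \<notin> \<Omega> \<longrightarrow> w x = 0}"

definition X0_norm :: "real \<Rightarrow> (real \<Rightarrow> real) \<Rightarrow> ('a::euclidean_space \<Rightarrow> real) \<Rightarrow> real" where
  "X0_norm p k w = enn2real (energy p k w) powr (1 / p)"

definition X0_dual :: "'a::euclidean_space set \<Rightarrow> real \<Rightarrow> (real \<Rightarrow> real) \<Rightarrow> (('a \<Rightarrow> real) \<Rightarrow> real) set" where
  "X0_dual \<Omega> p k = dual_space (X0_space \<Omega> p k) (X0_norm p k)"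

definition H_coeffs :: "real \<Rightarrow> real \<Rightarrow> ('a::euclidean_space \<times> 'a \<Rightarrow> real) set" where
  "H_coeffs hmin hmax = {h \<in> borel_measurable (lborel \<Otimes>\<^sub>M lborel).
     AE (x', x) in lborel \<Otimes>\<^sub>M lborel. h (x', x) = h (x, x') \<and> hmin \<le> h (x', x) \<and> h (x', x) \<le> hmax}"

definition Bh :: "real \<Rightarrow> (real \<Rightarrow> real) \<Rightarrow> ('a::euclidean_space \<times> 'a \<Rightarrow> real) \<Rightarrow>
    ('a \<Rightarrow> real) \<Rightarrow> ('a \<Rightarrow> real) \<Rightarrow> real" where
  "Bh p k h u v =
     (\<integral>(x', x). h (x', x) * k (norm (x' - x)) *
        (\<bar>u x' - u x\<bar> powr (p - 2) * (u x' - u x) * (v x' - v x) / norm (x' - x) powr p)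
        \<partial>(lborel \<Otimes>\<^sub>M lborel))"

definition Lop :: "real \<Rightarrow> (real \<Rightarrow> real) \<Rightarrow> ('a::euclidean_space \<times> 'a \<Rightarrow> real) \<Rightarrow>
    ('a \<Rightarrow> real) \<Rightarrow> (('a \<Rightarrow> real) \<Rightarrow> real)" where
  "Lop p k h u = (\<lambda>v. Bh p k h u v)"

text \<open>The solution is unique only up to null sets; \<open>Linv\<close> selects a representative.\<close>

definition Linv :: "'a::euclidean_space set \<Rightarrow> real \<Rightarrow> (real \<Rightarrow> real) \<Rightarrow> ('a \<times> 'a \<Rightarrow> real) \<Rightarrow>
    (('a \<Rightarrow> real) \<Rightarrow> real) \<Rightarrow> 'a \<Rightarrow> real" where
  "Linv \<Omega> p k h f =
     (SOME u. u \<in> X0_space \<Omega> p k \<and> (\<forall>v\<in>X0_space \<Omega> p k. Lop p k h u v = f v))"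

definition conj_exp :: "real \<Rightarrow> real" where
  "conj_exp p = p / (p - 1)"

definition flux :: "real \<Rightarrow> (real \<Rightarrow> real) \<Rightarrow> ('a::euclidean_space \<times> 'a \<Rightarrow> real) \<Rightarrow>
    ('a \<Rightarrow> real) \<Rightarrow> 'a \<times> 'a \<Rightarrow> real" where
  "flux p k h u = (\<lambda>(x', x). h (x', x) * k (norm (x' - x)) powr (1 / conj_exp p) *
     (\<bar>u x' - u x\<bar> powr (p - 2) * (u x' - u x) / norm (x' - x) powr (p - 1)))"

definition H_converges :: "'a::euclidean_space set \<Rightarrow> real \<Rightarrow> (real \<Rightarrow> real) \<Rightarrow>
    (nat \<Rightarrow> 'a \<times> 'a \<Rightarrow> real) \<Rightarrow> ('a \<times> 'a \<Rightarrow> real) \<Rightarrow> bool" where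
  "H_converges \<Omega> p k hs h \<longleftrightarrow> (\<forall>f\<in>X0_dual \<Omega> p k.
     weakly_converges (X0_space \<Omega> p k) (X0_norm p k)
       (\<lambda>j. Linv \<Omega> p k (hs j) f) (Linv \<Omega> p k h f) \<and>
     weakly_converges (Lp_space (conj_exp p) (lborel \<Otimes>\<^sub>M lborel))
       (Lp_norm (conj_exp p) (lborel \<Otimes>\<^sub>M lborel))
       (\<lambda>j. flux p k (hs j) (Linv \<Omega> p k (hs j) f)) (flux p k h (Linv \<Omega> p k h f)))"

section \<open>Admissible kernels\<close>

text \<open>Integrability is required on bounded sets only: by the lemma below, a kernel satisfying the
  lower bound on all of the punctured space is never integrable over the whole space. Given
  integrability over the whole space, the tail condition would be redundant.\<close>

definition admissible_kernel :: "'a::euclidean_space itself \<Rightarrow> real \<Rightarrow> real \<Rightarrow> real \<Rightarrow> (real \<Rightarrow> real) \<Rightarrow> bool" where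
  "admissible_kernel TYPE('a) p s c0 k \<longleftrightarrow>
     (\<forall>z::'a. z \<noteq> 0 \<longrightarrow> 0 < k (norm z)) \<and>
     (\<forall>R>0. set_integrable lborel (ball (0::'a) R) (\<lambda>z. k (norm z))) \<and>
     (\<forall>\<epsilon>>0. set_integrable lborel (- ball (0::'a) \<epsilon>) (\<lambda>z. k (norm z) / norm z powr p)) \<and>
     (\<forall>z::'a. z \<noteq> 0 \<longrightarrow> c0 / norm z powr (real DIM('a) + (s - 1) * p) \<le> k (norm z))"

lemma lower_bound_not_integrable:
  fixes k :: "real \<Rightarrow> real"
  assumes "0 < c0" "s < 1" "1 < p"
    and low: "\<And>z::'a::euclidean_space. z \<noteq> 0 \<Longrightarrow>
           c0 / norm z powr (real DIM('a) + (s - 1) * p) \<le> k (norm z)"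
  shows "\<not> integrable lborel (\<lambda>z::'a. k (norm z))"
proof
  assume int: "integrable lborel (\<lambda>z::'a. k (norm z))"
  define n where "n = real DIM('a)"
  define d where "d = (1 - s) * p"
  have d: "0 < d" using assms by (simp add: d_def)
  have n: "0 < n" by (simp add: n_def)
  define I where "I = (\<integral>z. \<bar>k (norm (z::'a))\<bar> \<partial>lborel)"
  have bound: "c0 * unit_ball_vol n * (1 - 2 powr (-n)) * min 1 (2 powr (n - d)) * R powr d \<le> I"
    if R: "0 < R" for R
  proof -
    let ?A = "ball (0::'a) R - ball 0 (R/2)"
    let ?m = "c0 * min 1 (2 powr (n - d)) * R powr (d - n)"
    have low': "?m \<le> k (norm z)" if "z \<in> ?A" for z :: 'a
    proof -
      have z: "R / 2 \<le> norm z" "norm z \<le> R" using that by auto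
      then have z0: "z \<noteq> 0" using R by auto
      have "min 1 (2 powr (n - d)) * R powr (d - n) \<le> norm z powr (d - n)"
      proof (cases "d \<le> n")
        case True
        have "min 1 (2 powr (n - d)) * R powr (d - n) \<le> 1 * R powr (d - n)"
          by (intro mult_right_mono) auto
        also have "\<dots> \<le> norm z powr (d - n)"
          using powr_mono2'[of "d - n" "norm z" R] True z z0 by simp
        finally show ?thesis .
      next
        case False
        have "min 1 (2 powr (n - d)) * R powr (d - n) \<le> 2 powr (n - d) * R powr (d - n)"
          by (intro mult_right_mono) auto
        also have "\<dots> = (R / 2) powr (d - n)"
        proof -
          have e: "n - d = - (d - n)" by simp
          show ?thesis using R unfolding e powr_minus_divide by (simp add: powr_divide)
        qed
        also have "\<dots> \<le> norm z powr (d - n)"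
          using powr_mono2[of "d - n" "R / 2" "norm z"] False z R by simp
        finally show ?thesis .
      qed
      then have "?m \<le> c0 * norm z powr (d - n)"
        using \<open>0 < c0\<close> by (simp add: mult.assoc)
      also have "\<dots> = c0 / norm z powr (n + (s - 1) * p)"
      proof -
        have e: "d - n = - (n + (s - 1) * p)" by (simp add: d_def algebra_simps)
        show ?thesis unfolding e powr_minus_divide by simp
      qed
      also have "\<dots> \<le> k (norm z)" using low[OF z0] by (simp add: n_def)
      finally show ?thesis .
    qed
    have fin: "emeasure lborel (ball (0::'a) r) < \<infinity>" for r
      by (rule emeasure_bounded_finite) simp
    have m: "measure lborel ?A = unit_ball_vol n * R powr n - unit_ball_vol n * (R/2) powr n"
      using R fin[of R] by (subst measure_Diff) (auto simp: content_ball n_def powr_realpow)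
    have "?m * measure lborel ?A = (\<integral>z. ?m * indicator ?A z \<partial>lborel)"
      by simp
    also have "\<dots> \<le> I"
      unfolding I_def
    proof (rule integral_mono)
      show "integrable lborel (\<lambda>z. ?m * indicator ?A z)"
        by (intro integrable_mult_right integrable_real_indicator)
          (auto intro: order.strict_trans1[OF emeasure_mono[of _ "ball (0::'a) R"]] simp: fin[simplified])
      show "integrable lborel (\<lambda>z::'a. \<bar>k (norm z)\<bar>)" using int by (rule integrable_abs)
      show "?m * indicator ?A z \<le> \<bar>k (norm z)\<bar>" for z :: 'a
        using low'[of z] by (cases "z \<in> ?A") (auto simp del: Diff_iff)
    qed
    finally have "?m * (unit_ball_vol n * R powr n - unit_ball_vol n * (R/2) powr n) \<le> I"
      unfolding m .
    moreover have "(R/2) powr n = 2 powr (-n) * R powr n"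
      using R by (simp add: powr_divide powr_minus_divide)
    ultimately have "c0 * min 1 (2 powr (n - d)) * unit_ball_vol n * (1 - 2 powr (-n)) *
        (R powr (d - n) * R powr n) \<le> I"
      by (simp only: left_diff_distrib right_diff_distrib mult_1_right mult_1_left mult_ac)
    then show ?thesis
      by (simp only: powr_add[symmetric] diff_add_cancel) (simp only: mult_ac)
  qed
  define C where "C = c0 * unit_ball_vol n * (1 - 2 powr (-n)) * min 1 (2 powr (n - d))"
  have "2 powr (-n) < (1::real)" using n by (simp add: powr_less_one)
  moreover have "0 < unit_ball_vol n" using n by simp
  ultimately have C: "0 < C" using \<open>0 < c0\<close> by (simp add: C_def)
  have "((\<bar>I\<bar> + 1) / C) powr (1/d) > 0" using C by (intro powr_gt_zero[THEN iffD2]) auto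
  from bound[OF this] have "C * ((\<bar>I\<bar> + 1) / C) \<le> I"
    using d C by (simp add: C_def[symmetric] powr_powr)
  then show False using C by simp
qed

end

theory Submission
  imports Defs
begin

text \<open>
  Write \<open>\<mu>\<close> for the measure \<open>k(|x' - x|) / |x' - x|^p dx' dx\<close> and \<open>Du(x', x) = u(x') - u(x)\<close>.
  Then the energy of \<open>u\<close> is the \<open>p\<close>-th power of the norm of \<open>Du\<close> in \<open>L^p(\<mu>)\<close>, the form \<open>B_h(u, v)\<close>
  is the integral of \<open>h |Du|^(p-2) Du Dv\<close> against \<open>\<mu>\<close>, and the claim is that \<open>Du_j\<close> tends to \<open>Du\<close>
  in \<open>L^p(\<mu>)\<close>. A local operator would not have this property, since gradients of solutions may
  oscillate; here differences converge as soon as the functions do, except near the diagonal.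

  The mechanism has two halves. Testing the equation of \<open>u_j\<close> with \<open>u_j - u\<close> gives
  \<open>B_{h_j}(u_j, u_j - u) = f(u_j) - f(u)\<close>, which tends to \<open>0\<close> by weak convergence. The integrand
  \<open>h_j |a|^(p-2) a (a - b)\<close>, with \<open>a = Du_j\<close> and \<open>b = Du\<close>, controls \<open>|a - b|^p\<close> up to a multiple of
  \<open>|b|^p\<close> (\<open>power_flux_coercive\<close>). That error is small near the diagonal, because \<open>b\<close> is one fixed
  function of \<open>L^p(\<mu>)\<close>. Away from the diagonal, the strong convergence of \<open>Du_j\<close> is established
  separately. Lemma \<open>strong_convergence_of_coercive_pairing\<close> combines the two regions, on an arbitrary
  measure space.

  Away from the diagonal the tail condition on the kernel bounds \<open>Dw\<close> in \<open>L^p(\<mu>)\<close> by \<open>w\<close> in \<open>L^p\<close>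
  (\<open>far_increments_le\<close>), so \<open>u_j\<close> has to converge strongly in \<open>L^p\<close>. This is the compactness of the
  embedding of \<open>X_0\<close> (\<open>strong_Lp_convergence\<close>): by the lower bound on the kernel, a function of
  bounded energy differs little in \<open>L^p\<close> from its averages over small balls, and for a fixed radius
  these averages are bounded functionals on \<open>X_0\<close> (\<open>poincare\<close>), so they converge under weak convergence.

  The equation of \<open>u_j\<close> can be tested only if \<open>u_j\<close> solves it. As \<open>Linv\<close> is a choice, the indices
  \<open>j\<close> for which there is no solution share one value \<open>e\<close>. If \<open>e\<close> occurs infinitely often, the strong
  convergence in \<open>L^p\<close> forces \<open>e = u\<close> almost everywhere, and then \<open>B_{h_j}(u_j, u_j - u)\<close> vanishes
  at these indices as well.
\<close>

section \<open>The power nonlinearity and convergence from a coercive pairing\<close>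

text \<open>The derivative of \<open>|t|^p / p\<close>.\<close>
definition power_flux :: "real \<Rightarrow> real \<Rightarrow> real" where
  "power_flux p t = \<bar>t\<bar> powr (p - 2) * t"

lemma power_flux_measurable [measurable]: "power_flux p \<in> borel_measurable borel"
  unfolding power_flux_def by measurable

lemma abs_power_flux: "\<bar>power_flux p t\<bar> = \<bar>t\<bar> powr (p - 1)"
proof (cases "t = 0")
  case False
  then have "\<bar>t\<bar> powr (p - 2) * \<bar>t\<bar> powr 1 = \<bar>t\<bar> powr (p - 1)"
    by (subst powr_add[symmetric]) simp
  with False show ?thesis by (simp add: power_flux_def abs_mult)
qed (simp add: power_flux_def)

lemma power_flux_mult_self: "power_flux p t * t = \<bar>t\<bar> powr p"
proof (cases "t = 0")
  case False
  then have "\<bar>t\<bar> powr (p - 2) * \<bar>t\<bar> powr 2 = \<bar>t\<bar> powr p"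
    by (subst powr_add[symmetric]) simp
  moreover have "\<bar>t\<bar> powr 2 = t * t"
    using False by (simp add: power2_eq_square)
  ultimately show ?thesis by (simp add: power_flux_def mult.assoc)
qed (simp add: power_flux_def)

text \<open>A substitute for the inequalities of Young and Hoelder with crude constants: compare \<open>y\<close> with
  \<open>\<eta> x\<close>.\<close>
lemma powr_mult_le_weighted_sum:
  fixes x y :: real
  assumes "1 < p" "0 < \<eta>" "0 \<le> x" "0 \<le> y"
  shows "x powr (p - 1) * y \<le> \<eta> * x powr p + \<eta> powr (1 - p) * y powr p"
proof (cases "y \<le> \<eta> * x")
  case True
  have "x powr (p - 1) * y \<le> x powr (p - 1) * (\<eta> * x)"
    using True by (intro mult_left_mono) auto
  also have "\<dots> = \<eta> * x powr p"
    using assms powr_mult_base[of x "p - 1"] by (simp add: mult_ac)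
  finally show ?thesis by (simp add: add_increasing2)
next
  case False
  then have "x \<le> y / \<eta>" using assms by (simp add: field_simps)
  then have "x powr (p - 1) * y \<le> (y / \<eta>) powr (p - 1) * y"
    using assms by (intro mult_right_mono powr_mono2) auto
  also have "\<dots> = \<eta> powr (1 - p) * y powr p"
  proof -
    have e: "1 - p = - (p - 1)" by simp
    show ?thesis
      unfolding e powr_minus using assms powr_mult_base[of y "p - 1"]
      by (simp add: powr_divide field_simps)
  qed
  finally show ?thesis using assms by (simp add: add_increasing)
qed

lemma add_powr_le:
  fixes x y :: real
  assumes "0 < p" "0 \<le> x" "0 \<le> y"
  shows "(x + y) powr p \<le> 2 powr p * (x powr p + y powr p)"
proof -
  have "(x + y) powr p \<le> (2 * max x y) powr p"
    using assms by (intro powr_mono2) auto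
  also have "\<dots> = 2 powr p * max x y powr p" using assms by (simp add: powr_mult)
  also have "max x y powr p \<le> x powr p + y powr p" by (simp add: max_def)
  finally show ?thesis by simp
qed

lemma abs_diff_powr_le:
  fixes x y :: real
  assumes "0 < p"
  shows "\<bar>x - y\<bar> powr p \<le> 2 powr p * (\<bar>x\<bar> powr p + \<bar>y\<bar> powr p)"
proof -
  have "\<bar>x - y\<bar> powr p \<le> (\<bar>x\<bar> + \<bar>y\<bar>) powr p" using assms by (intro powr_mono2) auto
  also have "\<dots> \<le> 2 powr p * (\<bar>x\<bar> powr p + \<bar>y\<bar> powr p)" using assms by (intro add_powr_le) auto
  finally show ?thesis .
qed

text \<open>When \<open>|a| \<ge> 2 |b|\<close>, the term \<open>|a|^p\<close> dominates \<open>|a|^(p-2) a b\<close> and the pairing alone suffices;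
  otherwise everything is bounded by a multiple of \<open>|b|^p\<close>. Tolerating this error term makes one
  argument serve for \<open>p < 2\<close> and for \<open>p \<ge> 2\<close>, where the usual strong monotonicity inequalities
  have different forms.\<close>
lemma power_flux_coercive:
  fixes a b p :: real
  assumes p: "1 < p"
  shows "\<bar>a - b\<bar> powr p \<le> 2 powr (p + 1) * (power_flux p a * (a - b)) + (3 powr p + 4 powr p) * \<bar>b\<bar> powr p"
proof -
  have pairing_ge: "power_flux p a * (a - b) \<ge> \<bar>a\<bar> powr p - \<bar>a\<bar> powr (p - 1) * \<bar>b\<bar>"
  proof -
    have "power_flux p a * b \<le> \<bar>a\<bar> powr (p - 1) * \<bar>b\<bar>"
      using abs_ge_self[of "power_flux p a * b"] by (simp add: abs_mult abs_power_flux)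
    then show ?thesis using power_flux_mult_self[of p a] by (simp add: right_diff_distrib)
  qed
  have base: "\<bar>a\<bar> powr (p - 1) * \<bar>a\<bar> = \<bar>a\<bar> powr p"
    using powr_mult_base[of "\<bar>a\<bar>" "p - 1"] by (simp add: mult.commute)
  show ?thesis
  proof (cases "2 * \<bar>b\<bar> \<le> \<bar>a\<bar>")
    case True
    have "\<bar>a\<bar> powr (p - 1) * \<bar>b\<bar> \<le> \<bar>a\<bar> powr (p - 1) * (\<bar>a\<bar> / 2)"
      using True by (intro mult_left_mono) auto
    then have half: "\<bar>a\<bar> powr p / 2 \<le> power_flux p a * (a - b)" using pairing_ge base by simp
    have "\<bar>a - b\<bar> powr p \<le> (2 * \<bar>a\<bar>) powr p"
      using True p by (intro powr_mono2) auto
    also have "\<dots> = 2 powr (p + 1) * (\<bar>a\<bar> powr p / 2)"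
      by (simp add: powr_mult powr_add)
    also have "\<dots> \<le> 2 powr (p + 1) * (power_flux p a * (a - b))"
      using half by (intro mult_left_mono) auto
    finally show ?thesis by (simp add: add_increasing2)
  next
    case False
    have "\<bar>a - b\<bar> powr p \<le> (3 * \<bar>b\<bar>) powr p"
      using False p by (intro powr_mono2) auto
    then have 1: "\<bar>a - b\<bar> powr p \<le> 3 powr p * \<bar>b\<bar> powr p" by (simp add: powr_mult)
    have "\<bar>a\<bar> powr (p - 1) * \<bar>b\<bar> \<le> (2 * \<bar>b\<bar>) powr (p - 1) * \<bar>b\<bar>"
      using False p by (intro mult_right_mono powr_mono2) auto
    also have "\<dots> = 2 powr (p - 1) * \<bar>b\<bar> powr p"
      using powr_mult_base[of "\<bar>b\<bar>" "p - 1"] by (simp add: powr_mult mult_ac)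
    finally have "- (2 powr (p - 1) * \<bar>b\<bar> powr p) \<le> power_flux p a * (a - b)"
      using pairing_ge powr_ge_zero[of "\<bar>a\<bar>" p] by linarith
    then have "2 powr (p + 1) * - (2 powr (p - 1) * \<bar>b\<bar> powr p) \<le> 2 powr (p + 1) * (power_flux p a * (a - b))"
      by (intro mult_left_mono) auto
    moreover have "2 powr (p + 1) * (2 powr (p - 1)) = (4::real) powr p"
    proof -
      have "2 powr (p + 1) * (2 powr (p - 1)) = (2::real) powr (2 * p)"
        by (subst powr_add[symmetric]) simp
      also have "\<dots> = 4 powr p" by (subst powr_powr[symmetric]) simp
      finally show ?thesis .
    qed
    ultimately have 2: "- (4 powr p * \<bar>b\<bar> powr p) \<le> 2 powr (p + 1) * (power_flux p a * (a - b))"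
      by (metis mult.assoc mult_minus_right)
    show ?thesis using 1 2 unfolding distrib_right by linarith
  qed
qed

lemma integrable_power_flux_mult:
  assumes p: "1 < p" and [measurable]: "a \<in> borel_measurable M" "b \<in> borel_measurable M" "h \<in> borel_measurable M"
    and ia: "integrable M (\<lambda>x. \<bar>a x\<bar> powr p)" and ib: "integrable M (\<lambda>x. \<bar>b x\<bar> powr p)"
    and h: "AE x in M. \<bar>h x\<bar> \<le> H"
  shows "integrable M (\<lambda>x. h x * (power_flux p (a x) * b x))"
proof (rule Bochner_Integration.integrable_bound)
  show "integrable M (\<lambda>x. H * (\<bar>a x\<bar> powr p + \<bar>b x\<bar> powr p))" using ia ib by auto
  show "AE x in M. norm (h x * (power_flux p (a x) * b x)) \<le> norm (H * (\<bar>a x\<bar> powr p + \<bar>b x\<bar> powr p))"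
    using h
  proof eventually_elim
    case (elim x)
    have "\<bar>a x\<bar> powr (p - 1) * \<bar>b x\<bar> \<le> \<bar>a x\<bar> powr p + \<bar>b x\<bar> powr p"
      using powr_mult_le_weighted_sum[OF p, of 1 "\<bar>a x\<bar>" "\<bar>b x\<bar>"] by simp
    then have "\<bar>h x\<bar> * (\<bar>a x\<bar> powr (p - 1) * \<bar>b x\<bar>) \<le> H * (\<bar>a x\<bar> powr p + \<bar>b x\<bar> powr p)"
      using elim by (intro mult_mono) auto
    also have "\<dots> \<le> norm (H * (\<bar>a x\<bar> powr p + \<bar>b x\<bar> powr p))" by simp
    finally show ?case by (simp add: abs_mult abs_power_flux)
  qed
qed measurable

text \<open>On the complement of \<open>A n\<close> the coercivity inequality leaves an error governed by the part of
  \<open>|b|^p\<close> outside \<open>A n\<close>, which is small uniformly in \<open>j\<close>. The price is that the pairing is known to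
  be small only as an integral over the whole space; its part over \<open>A n\<close> is controlled by the
  assumed convergence there, together with the bound on the norms of \<open>a j\<close>.\<close>
lemma strong_convergence_of_coercive_pairing:
  fixes a h :: "nat \<Rightarrow> 'b \<Rightarrow> real" and b :: "'b \<Rightarrow> real"
  assumes p: "1 < p" and hmin: "0 < hmin"
    and a_meas [measurable]: "\<And>j. a j \<in> borel_measurable M"
    and b_meas [measurable]: "b \<in> borel_measurable M"
    and h_meas [measurable]: "\<And>j. h j \<in> borel_measurable M"
    and ia: "\<And>j. integrable M (\<lambda>x. \<bar>a j x\<bar> powr p)"
    and ib: "integrable M (\<lambda>x. \<bar>b x\<bar> powr p)"
    and h: "\<And>j. AE x in M. hmin \<le> h j x \<and> h j x \<le> hmax"
    and K: "\<And>j. (\<integral>x. \<bar>a j x\<bar> powr p \<partial>M) \<le> K"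
    and pairing: "(\<lambda>j. \<integral>x. h j x * (power_flux p (a j x) * (a j x - b x)) \<partial>M) \<longlonglongrightarrow> 0"
    and A [measurable]: "\<And>n. A n \<in> sets M"
    and exhaust: "AE x in M. b x \<noteq> 0 \<longrightarrow> (\<forall>\<^sub>F n in sequentially. x \<in> A n)"
    and local: "\<And>n::nat. (\<lambda>j. \<integral>x. indicator (A n) x * \<bar>a j x - b x\<bar> powr p \<partial>M) \<longlonglongrightarrow> 0"
  shows "(\<lambda>j. \<integral>x. \<bar>a j x - b x\<bar> powr p \<partial>M) \<longlonglongrightarrow> 0"
proof -
  define W where "W j = (\<integral>x. \<bar>a j x - b x\<bar> powr p \<partial>M)" for j
  define I where "I j = (\<integral>x. h j x * (power_flux p (a j x) * (a j x - b x)) \<partial>M)" for j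
  define T where "T n j = (\<integral>x. indicator (A n) x * \<bar>a j x - b x\<bar> powr p \<partial>M)" for n j
  define \<beta> where "\<beta> n = (\<integral>x. indicator (- A n) x * \<bar>b x\<bar> powr p \<partial>M)" for n
  define C where "C = (3::real) powr p + 4 powr p"
  define H where "H = max 0 hmax"
  define L where "L \<eta> = H * (1 + 2 powr (p + 1) * \<eta> powr (1 - p))" for \<eta>
  have H: "0 \<le> H" by (simp add: H_def)
  have C: "0 \<le> C" by (simp add: C_def)
  have h': "AE x in M. hmin \<le> h j x \<and> \<bar>h j x\<bar> \<le> H" for j
    using h[of j] by eventually_elim (use hmin in \<open>auto simp: H_def\<close>)
  have iw: "integrable M (\<lambda>x. \<bar>a j x - b x\<bar> powr p)" for j
  proof (rule Bochner_Integration.integrable_bound)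
    show "integrable M (\<lambda>x. 2 powr p * (\<bar>a j x\<bar> powr p + \<bar>b x\<bar> powr p))" using ia ib by auto
    show "AE x in M. norm (\<bar>a j x - b x\<bar> powr p) \<le> norm (2 powr p * (\<bar>a j x\<bar> powr p + \<bar>b x\<bar> powr p))"
      using abs_diff_powr_le[of p] p by (auto intro!: AE_I2)
  qed measurable
  have ii: "integrable M (\<lambda>x. h j x * (power_flux p (a j x) * (a j x - b x)))" for j
    by (rule integrable_power_flux_mult[OF p]) (use h' ia iw in \<open>auto\<close>)
  have iT: "integrable M (\<lambda>x. indicator (A n) x * \<bar>a j x - b x\<bar> powr p)" for n j
    using integrable_mult_indicator[OF A iw, of n j] by simp
  have [measurable]: "(indicator (- A n) :: 'b \<Rightarrow> real) \<in> borel_measurable M" for n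
  proof -
    have "(\<lambda>x. 1 - indicator (A n) x :: real) \<in> borel_measurable M" by measurable
    also have "(\<lambda>x. 1 - indicator (A n) x :: real) = indicator (- A n)"
      by (auto simp: indicator_def)
    finally show ?thesis .
  qed
  have i\<beta>: "integrable M (\<lambda>x. indicator (- A n) x * \<bar>b x\<bar> powr p)" for n
    by (rule Bochner_Integration.integrable_bound[OF ib]) (auto simp: indicator_def)
  have \<beta>_lim: "\<beta> \<longlonglongrightarrow> 0"
  proof -
    have "(\<lambda>n. \<integral>x. indicator (- A n) x * \<bar>b x\<bar> powr p \<partial>M) \<longlonglongrightarrow> (\<integral>x. 0 \<partial>M)"
    proof (rule integral_dominated_convergence[OF _ _ ib])
      show "AE x in M. (\<lambda>n. indicator (- A n) x * \<bar>b x\<bar> powr p) \<longlonglongrightarrow> 0"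
        using exhaust
      proof eventually_elim
        case (elim x)
        then have "\<forall>\<^sub>F n in sequentially. indicator (- A n) x * \<bar>b x\<bar> powr p = 0"
          by (cases "b x = 0") (auto elim: eventually_mono)
        then show ?case by (rule tendsto_eventually)
      qed
      show "AE x in M. norm (indicator (- A n) x * \<bar>b x\<bar> powr p) \<le> \<bar>b x\<bar> powr p" for n
        by (auto simp: indicator_def)
    qed measurable
    then show ?thesis unfolding \<beta>_def[abs_def] by simp
  qed
  have est: "hmin * W j \<le> 2 powr (p + 1) * I j + H * C * \<beta> n + 2 powr (p + 1) * H * \<eta> * K + L \<eta> * T n j"
    if \<eta>: "0 < \<eta>" for \<eta> n j
  proof -
    \<comment> \<open>One pointwise bound covers both regions: on \<open>A n\<close> its first term may be negative and is
      compensated by the last two.\<close>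
    let ?r = "\<lambda>x. 2 powr (p + 1) * (h j x * (power_flux p (a j x) * (a j x - b x)))
      + H * C * (indicator (- A n) x * \<bar>b x\<bar> powr p)
      + 2 powr (p + 1) * H * \<eta> * \<bar>a j x\<bar> powr p
      + L \<eta> * (indicator (A n) x * \<bar>a j x - b x\<bar> powr p)"
    have "hmin * W j = (\<integral>x. hmin * \<bar>a j x - b x\<bar> powr p \<partial>M)" by (simp add: W_def)
    also have "\<dots> \<le> (\<integral>x. ?r x \<partial>M)"
    proof (rule integral_mono_AE)
      show "integrable M (\<lambda>x. hmin * \<bar>a j x - b x\<bar> powr p)" using iw by simp
      show "integrable M ?r"
        by (intro Bochner_Integration.integrable_add integrable_mult_right ii i\<beta> ia iT)
      show "AE x in M. hmin * \<bar>a j x - b x\<bar> powr p \<le> ?r x"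
        using h'[of j]
      proof eventually_elim
        case (elim x)
        let ?w = "a j x - b x"
        have h0: "0 \<le> h j x" "hmin \<le> h j x" "h j x \<le> H" using elim hmin by auto
        show ?case
        proof (cases "x \<in> A n")
          case True
          have "\<bar>h j x * (power_flux p (a j x) * ?w)\<bar> = h j x * (\<bar>a j x\<bar> powr (p - 1) * \<bar>?w\<bar>)"
            using h0 by (simp add: abs_mult abs_power_flux)
          also have "\<dots> \<le> H * (\<eta> * \<bar>a j x\<bar> powr p + \<eta> powr (1 - p) * \<bar>?w\<bar> powr p)"
            using h0 H by (intro mult_mono powr_mult_le_weighted_sum p \<eta>) auto
          finally have "0 \<le> h j x * (power_flux p (a j x) * ?w)
              + H * (\<eta> * \<bar>a j x\<bar> powr p + \<eta> powr (1 - p) * \<bar>?w\<bar> powr p)" by linarith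
          then have "0 \<le> 2 powr (p + 1) * (h j x * (power_flux p (a j x) * ?w)
              + H * (\<eta> * \<bar>a j x\<bar> powr p + \<eta> powr (1 - p) * \<bar>?w\<bar> powr p))" by simp
          moreover have "hmin * \<bar>?w\<bar> powr p \<le> H * \<bar>?w\<bar> powr p"
            using h0 by (intro mult_right_mono) auto
          ultimately show ?thesis using True by (simp add: L_def algebra_simps)
        next
          case False
          have "hmin * \<bar>?w\<bar> powr p \<le> h j x * \<bar>?w\<bar> powr p" using h0 by (intro mult_right_mono) auto
          also have "\<dots> \<le> h j x * (2 powr (p + 1) * (power_flux p (a j x) * ?w) + C * \<bar>b x\<bar> powr p)"
            using h0 power_flux_coercive[OF p, of "a j x" "b x"] by (intro mult_left_mono) (auto simp: C_def)
          also have "\<dots> = 2 powr (p + 1) * (h j x * (power_flux p (a j x) * ?w)) + h j x * (C * \<bar>b x\<bar> powr p)"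
            by (simp add: algebra_simps)
          also have "h j x * (C * \<bar>b x\<bar> powr p) \<le> H * (C * \<bar>b x\<bar> powr p)"
            using h0 C by (intro mult_right_mono) auto
          moreover have "0 \<le> 2 powr (p + 1) * H * \<eta> * \<bar>a j x\<bar> powr p" using H \<eta> by simp
          ultimately show ?thesis using False by (simp add: mult.assoc)
        qed
      qed
    qed
    also have "\<dots> = 2 powr (p + 1) * I j + H * C * \<beta> n
        + 2 powr (p + 1) * H * \<eta> * (\<integral>x. \<bar>a j x\<bar> powr p \<partial>M) + L \<eta> * T n j"
      unfolding I_def \<beta>_def T_def
      by (simp only: Bochner_Integration.integral_add Bochner_Integration.integrable_add
          integrable_mult_right ii i\<beta> ia iT integral_mult_right_zero)
    also have "2 powr (p + 1) * H * \<eta> * (\<integral>x. \<bar>a j x\<bar> powr p \<partial>M) \<le> 2 powr (p + 1) * H * \<eta> * K"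
      using K[of j] H \<eta> by (intro mult_left_mono) auto
    finally show ?thesis by simp
  qed
  have K0: "0 \<le> K" using K[of 0] by (smt (verit) integral_nonneg_AE AE_I2 powr_ge_zero)
  show ?thesis
    unfolding W_def[symmetric]
  proof (rule LIMSEQ_I)
    fix r :: real assume r: "0 < r"
    define \<epsilon> where "\<epsilon> = hmin * r / 4"
    have \<epsilon>: "0 < \<epsilon>" using r hmin by (simp add: \<epsilon>_def)
    define \<eta> where "\<eta> = \<epsilon> / (2 powr (p + 1) * H * K + 1)"
    have den: "0 < 2 powr (p + 1) * H * K + 1"
      using H K0 by (intro add_nonneg_pos mult_nonneg_nonneg) auto
    have \<eta>: "0 < \<eta>" using \<epsilon> den by (simp add: \<eta>_def)
    have "2 powr (p + 1) * H * \<eta> * K = \<epsilon> * ((2 powr (p + 1) * H * K) / (2 powr (p + 1) * H * K + 1))"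
      by (simp add: \<eta>_def)
    also have "\<dots> \<le> \<epsilon> * 1" using den \<epsilon> by (intro mult_left_mono) auto
    finally have e3: "2 powr (p + 1) * H * \<eta> * K \<le> \<epsilon>" by simp
    have "(\<lambda>n. H * C * \<beta> n) \<longlonglongrightarrow> H * C * 0" by (intro tendsto_intros \<beta>_lim)
    then have "\<forall>\<^sub>F n in sequentially. H * C * \<beta> n < \<epsilon>" using \<epsilon> by (intro order_tendstoD(2)) auto
    then obtain n where e2: "H * C * \<beta> n < \<epsilon>" by (auto simp: eventually_sequentially)
    have "(\<lambda>j. 2 powr (p + 1) * I j) \<longlonglongrightarrow> 2 powr (p + 1) * 0"
      using pairing unfolding I_def by (intro tendsto_intros)
    then have e1: "\<forall>\<^sub>F j in sequentially. 2 powr (p + 1) * I j < \<epsilon>"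
      using \<epsilon> by (intro order_tendstoD(2)) auto
    have "(\<lambda>j. L \<eta> * T n j) \<longlonglongrightarrow> L \<eta> * 0"
      using local[of n] unfolding T_def by (intro tendsto_intros)
    then have e4: "\<forall>\<^sub>F j in sequentially. L \<eta> * T n j < \<epsilon>"
      using \<epsilon> by (intro order_tendstoD(2)) auto
    have "\<forall>\<^sub>F j in sequentially. norm (W j - 0) < r"
      using e1 e4
    proof eventually_elim
      case (elim j)
      have "hmin * W j < 4 * \<epsilon>" using est[OF \<eta>, of j n] elim e2 e3 by linarith
      then have "W j < r" using hmin by (simp add: \<epsilon>_def)
      moreover have "0 \<le> W j" by (simp add: W_def)
      ultimately show ?case by simp
    qed
    then show "\<exists>n0. \<forall>n\<ge>n0. norm (W n - 0) < r" by (simp add: eventually_sequentially)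
  qed
qed

section \<open>Increments, far pairs and averages\<close>

definition incr :: "('a \<Rightarrow> real) \<Rightarrow> 'a \<times> 'a \<Rightarrow> real" where
  "incr w = (\<lambda>(x', x). w x' - w x)"

definition kernel_weight :: "real \<Rightarrow> (real \<Rightarrow> real) \<Rightarrow> 'a::euclidean_space \<times> 'a \<Rightarrow> real" where
  "kernel_weight p k = (\<lambda>(x', x). k (norm (x' - x)) / norm (x' - x) powr p)"

text \<open>With this measure, \<open>w \<mapsto> incr w\<close> embeds \<open>X_0\<close> isometrically into \<open>L^p\<close>.\<close>
definition kernel_measure :: "real \<Rightarrow> (real \<Rightarrow> real) \<Rightarrow> ('a::euclidean_space \<times> 'a) measure" where
  "kernel_measure p k = density (lborel \<Otimes>\<^sub>M lborel) (\<lambda>z. ennreal (kernel_weight p k z))"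

lemma sets_kernel_measure [simp, measurable_cong]:
  "sets (kernel_measure p k) = sets (lborel \<Otimes>\<^sub>M lborel)"
  by (simp add: kernel_measure_def)

lemma incr_measurable [measurable]:
  fixes w :: "'a::euclidean_space \<Rightarrow> real"
  assumes [measurable]: "w \<in> borel_measurable borel"
  shows "incr w \<in> borel_measurable (lborel \<Otimes>\<^sub>M lborel)"
  unfolding incr_def by measurable

lemma incr_diff: "incr (\<lambda>x. u x - v x) z = incr u z - incr v z"
  by (simp add: incr_def split: prod.splits)

lemma far_pairs_measurable:
  "{z :: 'a::euclidean_space \<times> 'a. \<delta> \<le> norm (fst z - snd z)} \<in> sets (lborel \<Otimes>\<^sub>M lborel)"
proof -
  have "closed {z :: 'a \<times> 'a. \<delta> \<le> norm (fst z - snd z)}"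
    by (intro closed_Collect_le continuous_intros)
  then have "{z :: 'a \<times> 'a. \<delta> \<le> norm (fst z - snd z)} \<in> sets borel" by (rule borel_closed)
  then have "{z :: 'a \<times> 'a. \<delta> \<le> norm (fst z - snd z)} \<in> sets (borel \<Otimes>\<^sub>M borel)"
    by (simp only: borel_prod)
  then show ?thesis by simp
qed

lemma near_pairs_measurable:
  "(\<lambda>(x, y). indicator (ball x r) y :: real) \<in> borel_measurable (lborel \<Otimes>\<^sub>M (lborel :: 'a::euclidean_space measure))"
proof -
  have "(\<lambda>(x, y). indicator (ball x r) y :: real) = (\<lambda>z. 1 - indicator {z :: 'a \<times> 'a. r \<le> norm (fst z - snd z)} z)"
    by (auto simp: fun_eq_iff indicator_def dist_norm)
  moreover note far_pairs_measurable[of r, measurable]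
  ultimately show ?thesis by simp
qed

text \<open>An increment vanishes on the diagonal, so the pairs at distance at least \<open>1 / (n + 1)\<close> exhaust
  the set that carries it.\<close>
lemma off_diagonal_eventually_far:
  fixes x y :: "'a::real_normed_vector"
  assumes "incr b (x, y) \<noteq> 0"
  shows "\<forall>\<^sub>F n in sequentially. (x, y) \<in> {z. 1 / real (Suc n) \<le> norm (fst z - snd z)}"
proof -
  have "0 < norm (x - y)" using assms by (auto simp: incr_def)
  then obtain m where m: "1 / real (Suc m) < norm (x - y)"
    using reals_Archimedean by (metis inverse_eq_divide)
  show ?thesis
    using eventually_ge_at_top[of m]
  proof eventually_elim
    case (elim n)
    then have "1 / real (Suc n) \<le> 1 / real (Suc m)" by (intro divide_left_mono) auto
    then show ?case using m by simp
  qed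
qed

lemma nn_integral_lborel_translate:
  fixes g :: "'a::euclidean_space \<Rightarrow> ennreal"
  assumes [measurable]: "g \<in> borel_measurable borel"
  shows "(\<integral>\<^sup>+x. g (x - c) \<partial>lborel) = (\<integral>\<^sup>+x. g x \<partial>lborel)"
proof -
  have "(\<integral>\<^sup>+x. g x \<partial>lborel) = (\<integral>\<^sup>+x. g x \<partial>(distr lborel borel ((+) (- c))))"
    by (simp add: lborel_distr_plus)
  also have "\<dots> = (\<integral>\<^sup>+x. g (x - c) \<partial>lborel)"
    by (subst nn_integral_distr) auto
  finally show ?thesis ..
qed

text \<open>Jensen's inequality for averages over a set of finite measure, obtained by integrating the
  inequality of Young between \<open>|g|\<close> and the average of \<open>g\<close>.\<close>
lemma powr_abs_set_integral_le:
  fixes g :: "'b \<Rightarrow> real"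
  assumes p: "1 < p" and [measurable]: "S \<in> sets M" "g \<in> borel_measurable M"
    and fin: "emeasure M S < \<infinity>" and int: "integrable M (\<lambda>x. \<bar>g x\<bar> powr p)"
  shows "set_integrable M S g"
    and "\<bar>\<integral>x\<in>S. g x \<partial>M\<bar> powr p \<le> measure M S powr (p - 1) * (\<integral>x\<in>S. \<bar>g x\<bar> powr p \<partial>M)"
proof -
  let ?V = "measure M S"
  have iS: "integrable M (indicator S :: _ \<Rightarrow> real)" using fin by simp
  have ip: "set_integrable M S (\<lambda>x. \<bar>g x\<bar> powr p)"
    unfolding set_integrable_def using integrable_mult_indicator[OF _ int] by simp
  show ig: "set_integrable M S g"
    unfolding set_integrable_def
  proof (rule Bochner_Integration.integrable_bound)
    show "integrable M (\<lambda>x. indicator S x + \<bar>g x\<bar> powr p)" using iS int by auto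
    have "\<bar>g x\<bar> \<le> 1 + \<bar>g x\<bar> powr p" for x
    proof (cases "\<bar>g x\<bar> \<le> 1")
      case False
      then have "\<bar>g x\<bar> powr 1 \<le> \<bar>g x\<bar> powr p" using p by (intro powr_mono) auto
      then show ?thesis by simp
    qed (simp add: add_increasing2)
    then show "AE x in M. norm (indicator S x *\<^sub>R g x) \<le> norm (indicator S x + \<bar>g x\<bar> powr p)"
      by (auto simp: indicator_def)
  qed measurable
  define J where "J = \<bar>\<integral>x\<in>S. g x \<partial>M\<bar>"
  define P where "P = (\<integral>x\<in>S. \<bar>g x\<bar> powr p \<partial>M)"
  have P0: "0 \<le> P" unfolding P_def set_lebesgue_integral_def by simp
  have J0: "0 \<le> J" by (simp add: J_def)
  have "J powr p \<le> ?V powr (p - 1) * P"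
  proof (cases "J = 0 \<or> ?V = 0")
    case True
    have "J = 0" if "?V = 0"
    proof -
      have "emeasure M S = 0" using that fin by (simp add: emeasure_eq_ennreal_measure top.not_eq_extremum)
      then have "AE x in M. x \<notin> S" by (intro AE_not_in) (auto simp: null_sets_def)
      then have "(\<integral>x\<in>S. g x \<partial>M) = (\<integral>x. 0 \<partial>M)"
        unfolding set_lebesgue_integral_def by (intro integral_cong_AE) auto
      then show ?thesis by (simp add: J_def)
    qed
    with True P0 show ?thesis by auto
  next
    case False
    then have V: "0 < ?V" and J: "0 < J" using J0 by (auto simp: zero_less_measure_iff less_le)
    define m where "m = J / ?V"
    have m: "0 < m" using V J by (simp add: m_def)
    have young: "m powr (p - 1) * t \<le> t powr p / p + (1 - 1 / p) * m powr p" if "0 \<le> t" for t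
    proof -
      have "t * m powr (p - 1) \<le> t powr p / p + (m powr (p - 1)) powr (p / (p - 1)) / (p / (p - 1))"
        using p that by (intro Youngs_inequality) (auto simp: field_simps)
      moreover have "(m powr (p - 1)) powr (p / (p - 1)) = m powr p" using p by (simp add: powr_powr)
      moreover have "m powr p / (p / (p - 1)) = (1 - 1 / p) * m powr p"
        using p by (simp add: field_simps)
      moreover have "m powr (p - 1) * t = t * m powr (p - 1)" by simp
      ultimately show ?thesis by metis
    qed
    have "m powr (p - 1) * J \<le> m powr (p - 1) * (\<integral>x\<in>S. \<bar>g x\<bar> \<partial>M)"
      using set_integral_norm_bound[OF ig] by (intro mult_left_mono) (auto simp: J_def)
    also have "\<dots> = (\<integral>x\<in>S. m powr (p - 1) * \<bar>g x\<bar> \<partial>M)" by simp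
    also have "\<dots> \<le> (\<integral>x\<in>S. \<bar>g x\<bar> powr p / p + (1 - 1 / p) * m powr p \<partial>M)"
      using ig ip iS young
      by (intro set_integral_mono set_integral_add set_integrable_divide set_integrable_mult_right
          set_integrable_abs) (auto simp: set_integrable_def)
    also have "\<dots> = P / p + (1 - 1 / p) * m powr p * ?V"
      using ip iS fin by (subst set_integral_add) (auto simp: P_def set_integrable_def set_lebesgue_integral_def top.not_eq_extremum)
    finally have "m powr (p - 1) * J \<le> P / p + (1 - 1 / p) * (m powr p * ?V)" by simp
    moreover have mJ: "m powr (p - 1) * J = m powr p * ?V"
      using powr_mult_base[of m "p - 1"] m V by (simp add: m_def field_simps)
    ultimately have "m powr p * ?V / p \<le> P / p" by (simp add: left_diff_distrib)
    then have "m powr p * ?V \<le> P" using p by (simp add: divide_le_cancel)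
    then have "?V powr (p - 1) * (m powr p * ?V) \<le> ?V powr (p - 1) * P" by (intro mult_left_mono) auto
    moreover have "?V powr (p - 1) * (m powr p * ?V) = J powr p"
      using powr_mult_base[of ?V "p - 1"] V J by (simp add: m_def powr_divide field_simps)
    ultimately show ?thesis by simp
  qed
  then show "\<bar>\<integral>x\<in>S. g x \<partial>M\<bar> powr p \<le> ?V powr (p - 1) * (\<integral>x\<in>S. \<bar>g x\<bar> powr p \<partial>M)"
    by (simp add: J_def P_def)
qed

section \<open>The energy space of an admissible kernel\<close>

context
  fixes p s c0 :: real and k :: "real \<Rightarrow> real"
  assumes p: "1 < p" and s: "0 < s" and c0: "0 < c0"
    and adm: "admissible_kernel TYPE('a::euclidean_space) p s c0 k"
begin

text \<open>Measurability is contained in the integrability on balls: let the radius grow.\<close>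
lemma kernel_borel_measurable: "(\<lambda>z::'a. k (norm z)) \<in> borel_measurable borel"
proof (rule borel_measurable_LIMSEQ_real)
  show "(\<lambda>z::'a. indicator (ball 0 (real (Suc n))) z *\<^sub>R k (norm z)) \<in> borel_measurable borel" for n
    using adm by (auto simp: admissible_kernel_def set_integrable_def
        dest!: spec[of _ "real (Suc n)"] borel_measurable_integrable)
  show "(\<lambda>n. indicator (ball 0 (real (Suc n))) z *\<^sub>R k (norm z)) \<longlonglongrightarrow> k (norm z)" for z :: 'a
  proof (rule tendsto_eventually)
    obtain m :: nat where m: "norm z < real m" using reals_Archimedean2 by blast
    show "\<forall>\<^sub>F n in sequentially. indicator (ball 0 (real (Suc n))) z *\<^sub>R k (norm z) = k (norm z)"
      using eventually_ge_at_top[of m] by eventually_elim (use m in auto)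
  qed
qed

lemma kernel_pos: "z \<noteq> 0 \<Longrightarrow> 0 < k (norm (z::'a))"
  using adm by (simp add: admissible_kernel_def)

lemma kernel_weight_nonneg: "0 \<le> kernel_weight p k (z :: 'a \<times> 'a)"
proof -
  have "0 \<le> k (norm (x - y)) / norm (x - y) powr p" for x y :: 'a
    using kernel_pos[of "x - y"] by (cases "x = y") auto
  then show ?thesis by (simp add: kernel_weight_def split: prod.splits)
qed

lemma kernel_weight_measurable [measurable]:
  "kernel_weight p k \<in> borel_measurable (lborel \<Otimes>\<^sub>M (lborel :: 'a measure))"
proof -
  note kernel_borel_measurable [measurable]
  have [measurable]: "(\<lambda>z::'a. k (norm z) / norm z powr p) \<in> borel_measurable borel" by measurable
  have "(\<lambda>z :: 'a \<times> 'a. (\<lambda>z. k (norm z) / norm z powr p) (fst z - snd z)) \<in> borel_measurable (lborel \<Otimes>\<^sub>M lborel)"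
    by (rule measurable_compose[where N = borel]) measurable
  then show ?thesis by (simp add: kernel_weight_def case_prod_unfold)
qed

lemma energy_eq_kernel_measure:
  fixes w :: "'a \<Rightarrow> real"
  assumes [measurable]: "w \<in> borel_measurable borel"
  shows "energy p k w = (\<integral>\<^sup>+z. ennreal (\<bar>incr w z\<bar> powr p) \<partial>kernel_measure p k)"
proof -
  have "(\<integral>\<^sup>+z. ennreal (\<bar>incr w z\<bar> powr p) \<partial>kernel_measure p k)
    = (\<integral>\<^sup>+z. ennreal (kernel_weight p k z) * ennreal (\<bar>incr w z\<bar> powr p) \<partial>(lborel \<Otimes>\<^sub>M lborel))"
    unfolding kernel_measure_def by (rule nn_integral_density) measurable
  also have "\<dots> = energy p k w"
    unfolding energy_def
    by (intro nn_integral_cong)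
      (auto simp: ennreal_mult[symmetric] kernel_weight_nonneg, simp add: kernel_weight_def incr_def)
  finally show ?thesis ..
qed

lemma X0_spaceD:
  assumes "w \<in> X0_space \<Omega> p k"
  shows "w \<in> borel_measurable (borel :: 'a measure)" "integrable lborel (\<lambda>x. \<bar>w x\<bar> powr p)"
    "energy p k w < \<infinity>" "AE x in lborel. x \<notin> \<Omega> \<longrightarrow> w x = 0"
    "integrable (kernel_measure p k) (\<lambda>z. \<bar>incr w z\<bar> powr p)"
    "energy p k w = ennreal (\<integral>z. \<bar>incr w z\<bar> powr p \<partial>kernel_measure p k)"
proof -
  show 1 [measurable]: "w \<in> borel_measurable borel" and "integrable lborel (\<lambda>x. \<bar>w x\<bar> powr p)"
    and 2: "energy p k w < \<infinity>" and "AE x in lborel. x \<notin> \<Omega> \<longrightarrow> w x = 0"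
    using assms by (auto simp: X0_space_def X_space_def Lp_space_def)
  show 3: "integrable (kernel_measure p k) (\<lambda>z. \<bar>incr w z\<bar> powr p)"
    using 2 unfolding energy_eq_kernel_measure[OF 1] by (intro integrableI_nonneg) auto
  show "energy p k w = ennreal (\<integral>z. \<bar>incr w z\<bar> powr p \<partial>kernel_measure p k)"
    unfolding energy_eq_kernel_measure[OF 1] by (rule nn_integral_eq_integral[OF 3]) auto
qed

lemma X0_space_diff:
  fixes u v :: "'a \<Rightarrow> real"
  assumes u: "u \<in> X0_space \<Omega> p k" and v: "v \<in> X0_space \<Omega> p k"
  shows "(\<lambda>x. u x - v x) \<in> X0_space \<Omega> p k"
    and "(\<integral>z. \<bar>incr (\<lambda>x. u x - v x) z\<bar> powr p \<partial>kernel_measure p k)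
      \<le> 2 powr p * ((\<integral>z. \<bar>incr u z\<bar> powr p \<partial>kernel_measure p k) + (\<integral>z. \<bar>incr v z\<bar> powr p \<partial>kernel_measure p k))"
proof -
  note U = X0_spaceD[OF u] and V = X0_spaceD[OF v]
  note U(1) [measurable] V(1) [measurable]
  have dp: "norm (\<bar>x - y\<bar> powr p) \<le> norm (2 powr p * (\<bar>x\<bar> powr p + \<bar>y\<bar> powr p))" for x y :: real
    using abs_diff_powr_le[of p x y] p by simp
  have i: "integrable (kernel_measure p k) (\<lambda>z. \<bar>incr u z - incr v z\<bar> powr p)"
    by (rule Bochner_Integration.integrable_bound[where
          f = "\<lambda>z. 2 powr p * (\<bar>incr u z\<bar> powr p + \<bar>incr v z\<bar> powr p)"])
      (use U(5) V(5) dp in \<open>auto intro!: AE_I2\<close>)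
  have "integrable lborel (\<lambda>z. \<bar>u z - v z\<bar> powr p)"
    by (rule Bochner_Integration.integrable_bound[where
          f = "\<lambda>z. 2 powr p * (\<bar>u z\<bar> powr p + \<bar>v z\<bar> powr p)"])
      (use U(2) V(2) dp in \<open>auto intro!: AE_I2\<close>)
  moreover have "energy p k (\<lambda>x. u x - v x) < \<infinity>"
    using nn_integral_eq_integral[OF i] by (simp add: energy_eq_kernel_measure incr_diff)
  moreover have "AE x in lborel. x \<notin> \<Omega> \<longrightarrow> u x - v x = 0"
    using U(4) V(4) by eventually_elim auto
  ultimately show "(\<lambda>x. u x - v x) \<in> X0_space \<Omega> p k"
    by (auto simp: X0_space_def X_space_def Lp_space_def)
  have "(\<integral>z. \<bar>incr (\<lambda>x. u x - v x) z\<bar> powr p \<partial>kernel_measure p k)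
    \<le> (\<integral>z. 2 powr p * (\<bar>incr u z\<bar> powr p + \<bar>incr v z\<bar> powr p) \<partial>kernel_measure p k)"
    unfolding incr_diff using i U(5) V(5) p by (intro integral_mono abs_diff_powr_le) auto
  also have "\<dots> = 2 powr p * ((\<integral>z. \<bar>incr u z\<bar> powr p \<partial>kernel_measure p k) + (\<integral>z. \<bar>incr v z\<bar> powr p \<partial>kernel_measure p k))"
    using U(5) V(5) by simp
  finally show "(\<integral>z. \<bar>incr (\<lambda>x. u x - v x) z\<bar> powr p \<partial>kernel_measure p k)
      \<le> 2 powr p * ((\<integral>z. \<bar>incr u z\<bar> powr p \<partial>kernel_measure p k) + (\<integral>z. \<bar>incr v z\<bar> powr p \<partial>kernel_measure p k))" .
qed

text \<open>For \<open>|z| < r\<close> the lower bound on the kernel makes \<open>k(|z|) / |z|^p\<close> at least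
  \<open>c0 / r^(N + s p)\<close>. Applied with small \<open>r\<close> this gives compactness, and with large \<open>r\<close> the
  Poincare inequality.\<close>
lemma local_oscillation_le_energy:
  fixes w :: "'a \<Rightarrow> real"
  assumes [measurable]: "w \<in> borel_measurable borel" and r: "0 < r"
  shows "(\<integral>\<^sup>+x. \<integral>\<^sup>+y. indicator (ball x r) y * ennreal (\<bar>w x - w y\<bar> powr p) \<partial>lborel \<partial>lborel)
    \<le> ennreal (r powr (real DIM('a) + s * p) / c0) * energy p k w"
proof -
  let ?C = "r powr (real DIM('a) + s * p) / c0"
  have pt: "indicator (ball x r) y * \<bar>w x - w y\<bar> powr p
      \<le> ?C * (kernel_weight p k (x, y) * \<bar>incr w (x, y)\<bar> powr p)" for x y
  proof (cases "y \<in> ball x r \<and> x \<noteq> y")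
    case True
    define t where "t = norm (x - y)"
    have t: "0 < t" "t < r" using True by (auto simp: t_def dist_norm)
    let ?e = "real DIM('a) + s * p"
    have e: "real DIM('a) + (s - 1) * p = ?e - p" by (simp add: algebra_simps)
    have "c0 / t powr (?e - p) \<le> k t"
      using adm True unfolding admissible_kernel_def t_def e by (metis right_minus_eq)
    then have "c0 / t powr (?e - p) / t powr p \<le> k t / t powr p"
      by (intro divide_right_mono) auto
    also have "c0 / t powr (?e - p) / t powr p = c0 / t powr ?e"
      using t by (simp add: powr_diff)
    finally have "c0 / t powr ?e \<le> kernel_weight p k (x, y)" by (simp add: kernel_weight_def t_def)
    moreover have "c0 / r powr ?e \<le> c0 / t powr ?e"
      using t s p c0 by (intro divide_left_mono powr_mono2 mult_pos_pos) auto
    ultimately have "c0 / r powr ?e \<le> kernel_weight p k (x, y)" by simp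
    then have "1 \<le> ?C * kernel_weight p k (x, y)" using r c0 by (simp add: field_simps)
    then have "1 * \<bar>w x - w y\<bar> powr p \<le> ?C * kernel_weight p k (x, y) * \<bar>w x - w y\<bar> powr p"
      by (intro mult_right_mono) auto
    then show ?thesis using True by (simp add: incr_def mult.assoc)
  next
    case False
    then have "indicator (ball x r) y * \<bar>w x - w y\<bar> powr p = 0" by auto
    moreover have "0 \<le> ?C * (kernel_weight p k (x, y) * \<bar>incr w (x, y)\<bar> powr p)"
      using kernel_weight_nonneg[of "(x, y)"] c0 by simp
    ultimately show ?thesis by linarith
  qed
  have "(\<integral>\<^sup>+x. \<integral>\<^sup>+y. indicator (ball x r) y * ennreal (\<bar>w x - w y\<bar> powr p) \<partial>lborel \<partial>lborel)
    \<le> (\<integral>\<^sup>+x. \<integral>\<^sup>+y. ennreal ?C * (ennreal (kernel_weight p k (x, y)) * ennreal (\<bar>incr w (x, y)\<bar> powr p)) \<partial>lborel \<partial>lborel)"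
  proof (intro nn_integral_mono)
    fix x y
    have "indicator (ball x r) y * ennreal (\<bar>w x - w y\<bar> powr p) = ennreal (indicator (ball x r) y * \<bar>w x - w y\<bar> powr p)"
      by (auto simp: indicator_def)
    also have "\<dots> \<le> ennreal (?C * (kernel_weight p k (x, y) * \<bar>incr w (x, y)\<bar> powr p))"
      using pt by (rule ennreal_leI)
    also have "\<dots> = ennreal ?C * (ennreal (kernel_weight p k (x, y)) * ennreal (\<bar>incr w (x, y)\<bar> powr p))"
      using c0 kernel_weight_nonneg[of "(x, y)"] by (simp add: ennreal_mult del: times_divide_eq_left)
    finally show "indicator (ball x r) y * ennreal (\<bar>w x - w y\<bar> powr p)
      \<le> ennreal ?C * (ennreal (kernel_weight p k (x, y)) * ennreal (\<bar>incr w (x, y)\<bar> powr p))" .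
  qed
  also have "\<dots> = (\<integral>\<^sup>+z. ennreal ?C * (ennreal (kernel_weight p k z) * ennreal (\<bar>incr w z\<bar> powr p)) \<partial>(lborel \<Otimes>\<^sub>M lborel))"
    by (rule lborel.nn_integral_fst) measurable
  also have "\<dots> = ennreal ?C * (\<integral>\<^sup>+z. ennreal (kernel_weight p k z) * ennreal (\<bar>incr w z\<bar> powr p) \<partial>(lborel \<Otimes>\<^sub>M lborel))"
    by (rule nn_integral_cmult) measurable
  also have "(\<integral>\<^sup>+z. ennreal (kernel_weight p k z) * ennreal (\<bar>incr w z\<bar> powr p) \<partial>(lborel \<Otimes>\<^sub>M lborel)) = energy p k w"
    unfolding energy_eq_kernel_measure[OF assms(1)] kernel_measure_def
    by (rule nn_integral_density[symmetric]) measurable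
  finally show ?thesis .
qed


section \<open>Compactness and the increments away from the diagonal\<close>

text \<open>On a shell \<open>T\<close> outside of \<open>\<Omega>\<close> the function vanishes, so \<open>|w(x)|^p\<close> is the average over \<open>y\<close> in
  \<open>T\<close> of \<open>|w(x) - w(y)|^p\<close>, and these pairs have distance less than \<open>3 R\<close>.\<close>
lemma poincare:
  fixes \<Omega> :: "'a set"
  assumes \<Omega>: "\<Omega> \<subseteq> ball 0 R" and R: "0 < R"
  obtains C where "0 \<le> C"
    "\<And>w. w \<in> X0_space \<Omega> p k \<Longrightarrow> (\<integral>x. \<bar>w x\<bar> powr p \<partial>lborel) \<le> C * enn2real (energy p k w)"
proof -
  define T where "T = ball (0::'a) (2 * R) - ball 0 R"
  define V where "V = measure lborel T"
  define B where "B = (3 * R) powr (real DIM('a) + s * p) / c0"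
  have B: "0 \<le> B" using c0 by (simp add: B_def)
  have [measurable]: "T \<in> sets borel" by (simp add: T_def)
  have T_fin: "emeasure lborel T < \<infinity>"
    unfolding T_def by (rule emeasure_bounded_finite) (auto intro: bounded_subset[of "ball 0 (2 * R)"])
  have emT: "emeasure lborel T = ennreal V"
    using T_fin by (simp add: V_def emeasure_eq_ennreal_measure top.not_eq_extremum)
  have V: "0 < V"
  proof -
    obtain b :: 'a where b: "b \<in> Basis" using nonempty_Basis by blast
    \<comment> \<open>The shell contains a ball around a point of norm \<open>3 R / 2\<close>.\<close>
    have "ball ((3 / 2 * R) *\<^sub>R b) (R / 2) \<subseteq> T"
    proof
      fix y assume "y \<in> ball ((3 / 2 * R) *\<^sub>R b) (R / 2)"
      then have "norm ((3 / 2 * R) *\<^sub>R b - y) < R / 2" by (simp add: dist_norm)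
      moreover have "norm ((3 / 2 * R) *\<^sub>R b) = 3 / 2 * R" using b R by simp
      moreover have "norm ((3 / 2 * R) *\<^sub>R b) \<le> norm ((3 / 2 * R) *\<^sub>R b - y) + norm y"
        using norm_triangle_ineq[of "(3 / 2 * R) *\<^sub>R b - y" y] by simp
      moreover have "norm y \<le> norm ((3 / 2 * R) *\<^sub>R b - y) + norm ((3 / 2 * R) *\<^sub>R b)"
        using norm_triangle_ineq[of "y - (3 / 2 * R) *\<^sub>R b" "(3 / 2 * R) *\<^sub>R b"] by (simp add: norm_minus_commute)
      ultimately show "y \<in> T" by (simp add: T_def)
    qed
    then have "emeasure lborel (ball ((3 / 2 * R) *\<^sub>R b) (R / 2)) \<le> emeasure lborel T"
      by (intro emeasure_mono) auto
    moreover have "0 < emeasure lborel (ball ((3 / 2 * R) *\<^sub>R b) (R / 2))"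
      using content_ball_pos[of "R / 2" "(3 / 2 * R) *\<^sub>R b"] R by (simp add: measure_def enn2real_positive_iff)
    ultimately show ?thesis using emT by (metis ennreal_0 ennreal_less_zero_iff leD not_gr_zero order.strict_trans2)
  qed
  show ?thesis
  proof
    show "0 \<le> B / V" using B V by simp
    fix w assume w: "w \<in> X0_space \<Omega> p k"
    note W = X0_spaceD[OF w]
    note W(1) [measurable]
    have "ennreal V * (\<integral>\<^sup>+x. ennreal (\<bar>w x\<bar> powr p) \<partial>lborel)
        = (\<integral>\<^sup>+x. \<integral>\<^sup>+y. indicator T y * ennreal (\<bar>w x\<bar> powr p) \<partial>lborel \<partial>lborel)"
      by (simp add: nn_integral_multc nn_integral_cmult emT)
    also have "\<dots> \<le> (\<integral>\<^sup>+x. \<integral>\<^sup>+y. indicator (ball x (3 * R)) y * ennreal (\<bar>w x - w y\<bar> powr p) \<partial>lborel \<partial>lborel)"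
    proof (rule nn_integral_mono_AE)
      show "AE x in lborel. (\<integral>\<^sup>+y. indicator T y * ennreal (\<bar>w x\<bar> powr p) \<partial>lborel)
          \<le> (\<integral>\<^sup>+y. indicator (ball x (3 * R)) y * ennreal (\<bar>w x - w y\<bar> powr p) \<partial>lborel)"
        using W(4)
      proof eventually_elim
        case (elim x)
        show ?case
        proof (cases "x \<in> \<Omega>")
          case True
          then have x: "norm x < R" using \<Omega> by auto
          have "y \<in> ball x (3 * R) \<and> y \<notin> \<Omega>" if "y \<in> T" for y
            using that x \<Omega> norm_triangle_ineq4[of x y] by (auto simp: T_def dist_norm)
          then have "AE y in lborel. indicator T y * ennreal (\<bar>w x\<bar> powr p)
              \<le> indicator (ball x (3 * R)) y * ennreal (\<bar>w x - w y\<bar> powr p)"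
            using W(4) by (auto simp: indicator_def elim!: eventually_mono)
          then show ?thesis by (rule nn_integral_mono_AE)
        qed (use elim p in simp)
      qed
    qed
    also have "\<dots> \<le> ennreal B * energy p k w"
      unfolding B_def using R by (intro local_oscillation_le_energy) auto
    also have "energy p k w = ennreal (enn2real (energy p k w))" using W(3) by (simp add: less_top)
    also have "(\<integral>\<^sup>+x. ennreal (\<bar>w x\<bar> powr p) \<partial>lborel) = ennreal (\<integral>x. \<bar>w x\<bar> powr p \<partial>lborel)"
      by (rule nn_integral_eq_integral[OF W(2)]) auto
    finally have "ennreal (V * (\<integral>x. \<bar>w x\<bar> powr p \<partial>lborel)) \<le> ennreal (B * enn2real (energy p k w))"
      using V B by (simp add: ennreal_mult)
    then have "V * (\<integral>x. \<bar>w x\<bar> powr p \<partial>lborel) \<le> B * enn2real (energy p k w)"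
      using B by (subst (asm) ennreal_le_iff) auto
    then show "(\<integral>x. \<bar>w x\<bar> powr p \<partial>lborel) \<le> B / V * enn2real (energy p k w)"
      using V by (simp add: field_simps)
  qed
qed

text \<open>Through these functionals, bounded by the inequalities of Jensen and Poincare, weak convergence
  yields the pointwise convergence of averages.\<close>
lemma ball_integral_in_dual:
  fixes \<Omega> :: "'a set"
  assumes \<Omega>: "\<Omega> \<subseteq> ball 0 R" and R: "0 < R"
  shows "(\<lambda>v. \<integral>y\<in>ball x r. v y \<partial>lborel) \<in> X0_dual \<Omega> p k"
proof -
  obtain C where C: "0 \<le> C"
    "\<And>w. w \<in> X0_space \<Omega> p k \<Longrightarrow> (\<integral>x. \<bar>w x\<bar> powr p \<partial>lborel) \<le> C * enn2real (energy p k w)"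
    using poincare[OF \<Omega> R] by blast
  have fin: "emeasure lborel (ball x r) < \<infinity>" by (rule emeasure_bounded_finite) simp
  define D where "D = measure lborel (ball x r) powr (p - 1) * C"
  have D: "0 \<le> D" using C by (simp add: D_def)
  have int: "set_integrable lborel (ball x r) v" if "v \<in> X0_space \<Omega> p k" for v
    using X0_spaceD(1,2)[OF that] fin p by (intro powr_abs_set_integral_le(1)[OF p]) auto
  have bound: "\<bar>\<integral>y\<in>ball x r. v y \<partial>lborel\<bar> \<le> D powr (1 / p) * X0_norm p k v"
    if v: "v \<in> X0_space \<Omega> p k" for v
  proof -
    note V = X0_spaceD[OF v]
    note V(1) [measurable]
    have "\<bar>\<integral>y\<in>ball x r. v y \<partial>lborel\<bar> powr p
        \<le> measure lborel (ball x r) powr (p - 1) * (\<integral>y\<in>ball x r. \<bar>v y\<bar> powr p \<partial>lborel)"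
      by (rule powr_abs_set_integral_le(2)[OF p]) (use V fin in auto)
    also have "(\<integral>y\<in>ball x r. \<bar>v y\<bar> powr p \<partial>lborel) \<le> (\<integral>y. \<bar>v y\<bar> powr p \<partial>lborel)"
      unfolding set_lebesgue_integral_def using V(2) integrable_mult_indicator[OF _ V(2), of "ball x r"]
      by (intro integral_mono) (auto simp: indicator_def)
    also have "\<dots> \<le> C * enn2real (energy p k v)" by (rule C(2)[OF v])
    finally have "\<bar>\<integral>y\<in>ball x r. v y \<partial>lborel\<bar> powr p \<le> D * enn2real (energy p k v)"
      by (simp add: D_def mult_left_mono mult.assoc)
    then have "(\<bar>\<integral>y\<in>ball x r. v y \<partial>lborel\<bar> powr p) powr (1 / p) \<le> (D * enn2real (energy p k v)) powr (1 / p)"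
      using p by (intro powr_mono2) auto
    then show ?thesis using p D by (simp add: powr_powr powr_mult X0_norm_def)
  qed
  show ?thesis
    unfolding X0_dual_def dual_space_def
    using int bound by (auto intro!: exI[of _ "D powr (1 / p)"])
qed

text \<open>At distance at least \<open>\<delta>\<close> the function \<open>k(|z|) / |z|^p\<close> is integrable, so the triangle
  inequality and integration in one variable at a time suffice.\<close>
lemma far_increments_le:
  assumes \<delta>: "0 < \<delta>"
  obtains C where "\<And>w :: 'a \<Rightarrow> real. w \<in> borel_measurable borel \<Longrightarrow>
    integrable lborel (\<lambda>x. \<bar>w x\<bar> powr p) \<Longrightarrow> integrable (kernel_measure p k) (\<lambda>z. \<bar>incr w z\<bar> powr p) \<Longrightarrow>
    (\<integral>z. indicator {z. \<delta> \<le> norm (fst z - snd z)} z * \<bar>incr w z\<bar> powr p \<partial>kernel_measure p k)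
      \<le> C * (\<integral>x. \<bar>w x\<bar> powr p \<partial>lborel)"
proof -
  note kernel_borel_measurable [measurable]
  define g where "g z = indicator (- ball 0 \<delta>) z * (k (norm z) / norm z powr p)" for z :: 'a
  define K where "K = (\<integral>z. g z \<partial>lborel)"
  have g0: "0 \<le> g z" for z
    using kernel_pos[of z] \<delta> by (cases "z = 0") (auto simp: g_def indicator_def)
  have [measurable]: "g \<in> borel_measurable borel" unfolding g_def[abs_def] by measurable
  have g_sym: "g (x - y) = g (y - x)" for x y
    unfolding g_def by (simp add: norm_minus_commute indicator_def)
  have gint: "integrable lborel g"
    using adm \<delta> by (simp add: admissible_kernel_def set_integrable_def g_def[abs_def])
  have gK: "(\<integral>\<^sup>+z. ennreal (g z) \<partial>lborel) = ennreal K"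
    unfolding K_def by (rule nn_integral_eq_integral[OF gint]) (use g0 in auto)
  have K: "0 \<le> K" using g0 by (simp add: K_def)
  show ?thesis
  proof
    fix w :: "'a \<Rightarrow> real"
    assume w [measurable]: "w \<in> borel_measurable borel"
      and iw: "integrable lborel (\<lambda>x. \<bar>w x\<bar> powr p)"
      and ii: "integrable (kernel_measure p k) (\<lambda>z. \<bar>incr w z\<bar> powr p)"
    let ?A = "{z :: 'a \<times> 'a. \<delta> \<le> norm (fst z - snd z)}"
    let ?N = "\<integral>\<^sup>+x. ennreal (\<bar>w x\<bar> powr p) \<partial>lborel"
    note A [measurable] = far_pairs_measurable[of \<delta>]
    have conv: "(\<integral>\<^sup>+x. ennreal (g (x - c)) \<partial>lborel) = ennreal K" for c
      using nn_integral_lborel_translate[of "\<lambda>z. ennreal (g z)" c] gK by simp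
    have "(\<integral>\<^sup>+z. ennreal (indicator ?A z * \<bar>incr w z\<bar> powr p) \<partial>kernel_measure p k)
      = (\<integral>\<^sup>+z. ennreal (kernel_weight p k z) * ennreal (indicator ?A z * \<bar>incr w z\<bar> powr p) \<partial>(lborel \<Otimes>\<^sub>M lborel))"
      unfolding kernel_measure_def by (rule nn_integral_density) measurable
    also have "\<dots> \<le> (\<integral>\<^sup>+(x, y). ennreal (2 powr p) * (ennreal (g (y - x)) * ennreal (\<bar>w x\<bar> powr p)
        + ennreal (g (x - y)) * ennreal (\<bar>w y\<bar> powr p)) \<partial>(lborel \<Otimes>\<^sub>M lborel))"
    proof (rule nn_integral_mono, clarify)
      fix x y :: 'a
      have "kernel_weight p k (x, y) * (indicator ?A (x, y) * \<bar>incr w (x, y)\<bar> powr p) = g (x - y) * \<bar>w x - w y\<bar> powr p"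
        by (auto simp: g_def kernel_weight_def incr_def indicator_def)
      also have "\<dots> \<le> g (x - y) * (2 powr p * (\<bar>w x\<bar> powr p + \<bar>w y\<bar> powr p))"
        using g0 p by (intro mult_left_mono abs_diff_powr_le) auto
      also have "\<dots> = 2 powr p * (g (y - x) * \<bar>w x\<bar> powr p + g (x - y) * \<bar>w y\<bar> powr p)"
        by (simp add: g_sym[of y x] algebra_simps)
      finally have "ennreal (kernel_weight p k (x, y) * (indicator ?A (x, y) * \<bar>incr w (x, y)\<bar> powr p))
        \<le> ennreal (2 powr p * (g (y - x) * \<bar>w x\<bar> powr p + g (x - y) * \<bar>w y\<bar> powr p))" by (rule ennreal_leI)
      then show "ennreal (kernel_weight p k (x, y)) * ennreal (indicator ?A (x, y) * \<bar>incr w (x, y)\<bar> powr p)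
        \<le> ennreal (2 powr p) * (ennreal (g (y - x)) * ennreal (\<bar>w x\<bar> powr p)
        + ennreal (g (x - y)) * ennreal (\<bar>w y\<bar> powr p))"
        using g0 kernel_weight_nonneg[of "(x, y)"] by (simp add: ennreal_mult)
    qed
    also have "\<dots> = ennreal (2 powr p) * (
        (\<integral>\<^sup>+(x, y). ennreal (g (y - x)) * ennreal (\<bar>w x\<bar> powr p) \<partial>(lborel \<Otimes>\<^sub>M lborel))
      + (\<integral>\<^sup>+(x, y). ennreal (g (x - y)) * ennreal (\<bar>w y\<bar> powr p) \<partial>(lborel \<Otimes>\<^sub>M lborel)))"
      by (simp add: case_prod_unfold nn_integral_cmult nn_integral_add)
    also have "(\<integral>\<^sup>+(x, y). ennreal (g (y - x)) * ennreal (\<bar>w x\<bar> powr p) \<partial>(lborel \<Otimes>\<^sub>M lborel))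
      = (\<integral>\<^sup>+x. \<integral>\<^sup>+y. ennreal (g (y - x)) * ennreal (\<bar>w x\<bar> powr p) \<partial>lborel \<partial>lborel)"
      by (subst lborel.nn_integral_fst[symmetric]) auto
    also have "\<dots> = ennreal K * ?N"
      by (simp add: nn_integral_multc conv nn_integral_cmult)
    also have "(\<integral>\<^sup>+(x, y). ennreal (g (x - y)) * ennreal (\<bar>w y\<bar> powr p) \<partial>(lborel \<Otimes>\<^sub>M lborel))
      = (\<integral>\<^sup>+y. \<integral>\<^sup>+x. ennreal (g (x - y)) * ennreal (\<bar>w y\<bar> powr p) \<partial>lborel \<partial>lborel)"
      by (subst lborel_pair.nn_integral_snd[symmetric]) auto
    also have "\<dots> = ennreal K * ?N"
      by (simp add: nn_integral_multc conv nn_integral_cmult)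
    also have "?N = ennreal (\<integral>x. \<bar>w x\<bar> powr p \<partial>lborel)"
      by (rule nn_integral_eq_integral[OF iw]) auto
    also have "ennreal (2 powr p) * (ennreal K * ennreal (\<integral>x. \<bar>w x\<bar> powr p \<partial>lborel)
        + ennreal K * ennreal (\<integral>x. \<bar>w x\<bar> powr p \<partial>lborel))
      = ennreal (2 powr p * 2 * K * (\<integral>x. \<bar>w x\<bar> powr p \<partial>lborel))"
      using K by (simp add: ennreal_mult[symmetric] ennreal_plus[symmetric] del: ennreal_plus)
    also have "(\<integral>\<^sup>+z. ennreal (indicator ?A z * \<bar>incr w z\<bar> powr p) \<partial>kernel_measure p k)
        = ennreal (\<integral>z. indicator ?A z * \<bar>incr w z\<bar> powr p \<partial>kernel_measure p k)"
    proof (rule nn_integral_eq_integral)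
      show "integrable (kernel_measure p k) (\<lambda>z. indicator ?A z * \<bar>incr w z\<bar> powr p)"
        using integrable_mult_indicator[OF _ ii, of ?A] A by simp
    qed auto
    finally show "(\<integral>z. indicator ?A z * \<bar>incr w z\<bar> powr p \<partial>kernel_measure p k)
        \<le> 2 powr p * 2 * K * (\<integral>x. \<bar>w x\<bar> powr p \<partial>lborel)"
      using K by (subst (asm) ennreal_le_iff) auto
  qed
qed


text \<open>A Rellich theorem along sequences that converge weakly to \<open>0\<close>. The function differs from its
  averages over balls of radius \<open>r\<close> by at most \<open>r^(s p)\<close> times the energy (up to a constant, in the
  \<open>p\<close>-th power of the norm), whereas the averages tend to \<open>0\<close> pointwise, boundedly on the bounded
  set of interest. Letting \<open>j\<close> tend to infinity before \<open>r\<close> tends to \<open>0\<close> proves the claim.\<close>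
lemma strong_Lp_convergence:
  fixes \<Omega> :: "'a set" and w :: "nat \<Rightarrow> 'a \<Rightarrow> real"
  assumes \<Omega>: "\<Omega> \<subseteq> ball 0 R" and R: "0 < R"
    and w: "\<And>j. w j \<in> X0_space \<Omega> p k"
    and K: "\<And>j. enn2real (energy p k (w j)) \<le> K"
    and weak: "\<And>x r. (\<lambda>j. \<integral>y\<in>ball x r. w j y \<partial>lborel) \<longlonglongrightarrow> 0"
  shows "(\<lambda>j. \<integral>x. \<bar>w j x\<bar> powr p \<partial>lborel) \<longlonglongrightarrow> 0"
proof -
  note W = X0_spaceD[OF w]
  note W(1) [measurable] near_pairs_measurable [measurable]
  obtain C where C: "0 \<le> C"
    "\<And>w. w \<in> X0_space \<Omega> p k \<Longrightarrow> (\<integral>x. \<bar>w x\<bar> powr p \<partial>lborel) \<le> C * enn2real (energy p k w)"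
    using poincare[OF \<Omega> R] by blast
  have K0: "0 \<le> K" using K[of 0] enn2real_nonneg[of "energy p k (w 0)"] by linarith
  have WCK: "(\<integral>x. \<bar>w j x\<bar> powr p \<partial>lborel) \<le> C * K" for j
    using C(2)[OF w] mult_left_mono[OF K C(1)] order.trans by blast
  define V where "V r = measure lborel (ball (0::'a) r)" for r
  have ball_V: "measure lborel (ball x r) = V r" if "0 < r" for x :: 'a and r
    using that by (simp add: V_def content_ball)
  have V_pos: "0 < V r" if "0 < r" for r using content_ball_pos[OF that] by (simp add: V_def)
  have V_r: "V r = V 1 * r powr real DIM('a)" if "0 < r" for r
    using that by (simp add: V_def content_ball powr_realpow)
  have fin: "emeasure lborel (ball x r) < \<infinity>" for x :: 'a and r
    by (rule emeasure_bounded_finite) simp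
  define m where "m r j x = (\<integral>y\<in>ball x r. w j y \<partial>lborel) / V r" for r j x
  define osc where "osc r j x = (\<integral>\<^sup>+y. indicator (ball x r) y * ennreal (\<bar>w j x - w j y\<bar> powr p) \<partial>lborel)" for r j x
  define Q where "Q r j = (\<integral>x. indicator (ball 0 R) x * \<bar>m r j x\<bar> powr p \<partial>lborel)" for r j
  have [measurable]: "m r j \<in> borel_measurable borel" for r j
    unfolding m_def[abs_def] set_lebesgue_integral_def by measurable
  have near_eq: "(indicator (ball x r) y :: ennreal) = ennreal (case (x, y) of (x, y) \<Rightarrow> indicator (ball x r) y)"
    for x y :: 'a and r
    by (simp add: indicator_def)
  have [measurable]: "osc r j \<in> borel_measurable borel" for r j
    unfolding osc_def[abs_def] near_eq by measurable
  have m_bound: "\<bar>m r j x\<bar> powr p \<le> C * K / V r" if r: "0 < r" for r j x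
  proof -
    have "\<bar>\<integral>y\<in>ball x r. w j y \<partial>lborel\<bar> powr p \<le> V r powr (p - 1) * (\<integral>y\<in>ball x r. \<bar>w j y\<bar> powr p \<partial>lborel)"
      using powr_abs_set_integral_le(2)[OF p _ _ fin W(2), of x r j] by (simp add: ball_V[OF r])
    also have "(\<integral>y\<in>ball x r. \<bar>w j y\<bar> powr p \<partial>lborel) \<le> (\<integral>y. \<bar>w j y\<bar> powr p \<partial>lborel)"
      unfolding set_lebesgue_integral_def using W(2) integrable_mult_indicator[OF _ W(2), of "ball x r"]
      by (intro integral_mono) (auto simp: indicator_def)
    also have "\<dots> \<le> C * K" by (rule WCK)
    finally have "\<bar>\<integral>y\<in>ball x r. w j y \<partial>lborel\<bar> powr p \<le> V r powr (p - 1) * (C * K)"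
      by (simp add: mult_left_mono)
    then have "\<bar>m r j x\<bar> powr p \<le> V r powr (p - 1) * (C * K) / V r powr p"
      using V_pos[OF r] by (simp add: m_def powr_divide divide_right_mono)
    also have "\<dots> = C * K / V r" using V_pos[OF r] by (simp add: powr_diff)
    finally show ?thesis .
  qed
  have iQ0: "integrable lborel (\<lambda>x. C * K / V r * indicator (ball (0::'a) R) x)" for r
    using fin by (intro integrable_mult_right integrable_real_indicator) auto
  have iQ: "integrable lborel (\<lambda>x. indicator (ball 0 R) x * \<bar>m r j x\<bar> powr p)" if "0 < r" for r j
    by (rule Bochner_Integration.integrable_bound[OF iQ0[of r]])
      (use m_bound[OF that] V_pos[OF that] C(1) K0 in \<open>auto simp: indicator_def intro!: AE_I2\<close>)
  have Q_lim: "Q r \<longlonglongrightarrow> 0" if r: "0 < r" for r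
  proof -
    have "(\<lambda>j. \<integral>x. indicator (ball 0 R) x * \<bar>m r j x\<bar> powr p \<partial>lborel) \<longlonglongrightarrow> (\<integral>x. 0 \<partial>(lborel :: 'a measure))"
    proof (rule integral_dominated_convergence[OF _ _ iQ0[of r]])
      have "(\<lambda>j. \<bar>m r j x\<bar> powr p) \<longlonglongrightarrow> 0" for x
      proof -
        have "(\<lambda>j. m r j x) \<longlonglongrightarrow> 0 / V r"
          unfolding m_def using V_pos[OF r] by (intro tendsto_divide weak tendsto_const) auto
        then have "(\<lambda>j. \<bar>m r j x\<bar>) \<longlonglongrightarrow> 0" by (simp add: tendsto_rabs_zero)
        then have "(\<lambda>j. \<bar>m r j x\<bar> powr p) \<longlonglongrightarrow> 0 powr p"
          using p by (intro tendsto_powr2 tendsto_const) auto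
        then show ?thesis by simp
      qed
      then show "AE x in lborel. (\<lambda>j. indicator (ball 0 R) x * \<bar>m r j x\<bar> powr p) \<longlonglongrightarrow> 0"
        by (auto intro!: AE_I2 tendsto_mult_right_zero)
      show "AE x in lborel. norm (indicator (ball 0 R) x * \<bar>m r j x\<bar> powr p)
          \<le> C * K / V r * indicator (ball 0 R) x" for j
        using m_bound[OF r] by (auto simp: indicator_def)
    qed measurable
    then show ?thesis by (simp add: Q_def[abs_def])
  qed
  define D where "D = 2 powr p / V 1 / c0 * K"
  have D: "0 \<le> D" using V_pos[of 1] c0 K0 by (simp add: D_def)
  have main: "(\<integral>x. \<bar>w j x\<bar> powr p \<partial>lborel) \<le> D * r powr (s * p) + 2 powr p * Q r j" if r: "0 < r" for r j
  proof -
    have V: "0 < V r" by (rule V_pos[OF r])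
    have pt: "ennreal (\<bar>w j x\<bar> powr p) \<le> ennreal (2 powr p / V r) * osc r j x + ennreal (2 powr p * \<bar>m r j x\<bar> powr p)" for x
    proof -
      define g where "g y = indicator (ball x r) y * (w j x - w j y)" for y
      have [measurable]: "g \<in> borel_measurable borel" unfolding g_def[abs_def] by measurable
      have g_int: "integrable lborel (\<lambda>y. \<bar>g y\<bar> powr p)"
      proof (rule Bochner_Integration.integrable_bound)
        show "integrable lborel (\<lambda>y. 2 powr p * (\<bar>w j x\<bar> powr p * indicator (ball x r) y + \<bar>w j y\<bar> powr p))"
          using fin W(2) by (intro integrable_mult_right Bochner_Integration.integrable_add integrable_real_indicator) auto
        show "AE y in lborel. norm (\<bar>g y\<bar> powr p)
            \<le> norm (2 powr p * (\<bar>w j x\<bar> powr p * indicator (ball x r) y + \<bar>w j y\<bar> powr p))"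
          using abs_diff_powr_le[of p "w j x"] p by (auto simp: g_def indicator_def)
      qed measurable
      note jen = powr_abs_set_integral_le[OF p _ _ fin g_int, of x r]
      have "(\<integral>y\<in>ball x r. g y \<partial>lborel) = (\<integral>y\<in>ball x r. w j x - w j y \<partial>lborel)"
        unfolding set_lebesgue_integral_def by (intro Bochner_Integration.integral_cong) (auto simp: g_def indicator_def)
      also have "\<dots> = (\<integral>y\<in>ball x r. w j x \<partial>lborel) - (\<integral>y\<in>ball x r. w j y \<partial>lborel)"
        using fin[of x r] by (intro set_integral_diff powr_abs_set_integral_le(1)[OF p _ _ fin W(2)])
          (auto simp: set_integrable_def)
      also have "\<dots> = V r * (w j x - m r j x)"
        using V fin[of x r] by (simp add: m_def right_diff_distrib set_lebesgue_integral_def ball_V[OF r])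
      finally have g_avg: "(\<integral>y\<in>ball x r. g y \<partial>lborel) = V r * (w j x - m r j x)" .
      have gset: "(\<integral>y\<in>ball x r. \<bar>g y\<bar> powr p \<partial>lborel) = (\<integral>y. \<bar>g y\<bar> powr p \<partial>lborel)"
        unfolding set_lebesgue_integral_def by (intro Bochner_Integration.integral_cong) (auto simp: g_def indicator_def)
      have "(V r * \<bar>w j x - m r j x\<bar>) powr p \<le> V r powr (p - 1) * (\<integral>y. \<bar>g y\<bar> powr p \<partial>lborel)"
        using jen(2) V by (simp add: g_avg gset ball_V[OF r] abs_mult)
      then have "V r powr p * \<bar>w j x - m r j x\<bar> powr p \<le> V r powr p / V r * (\<integral>y. \<bar>g y\<bar> powr p \<partial>lborel)"
        using V by (simp add: powr_mult powr_diff)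
      then have osc_avg: "\<bar>w j x - m r j x\<bar> powr p \<le> (\<integral>y. \<bar>g y\<bar> powr p \<partial>lborel) / V r"
        using V by (simp add: field_simps)
      have osc_eq: "osc r j x = ennreal (\<integral>y. \<bar>g y\<bar> powr p \<partial>lborel)"
      proof -
        have "osc r j x = (\<integral>\<^sup>+y. ennreal (\<bar>g y\<bar> powr p) \<partial>lborel)"
          unfolding osc_def by (intro nn_integral_cong) (auto simp: g_def indicator_def)
        also have "\<dots> = ennreal (\<integral>y. \<bar>g y\<bar> powr p \<partial>lborel)"
          by (rule nn_integral_eq_integral[OF g_int]) auto
        finally show ?thesis .
      qed
      have "\<bar>w j x\<bar> powr p \<le> (\<bar>w j x - m r j x\<bar> + \<bar>m r j x\<bar>) powr p" using p by (intro powr_mono2) auto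
      also have "\<dots> \<le> 2 powr p * (\<bar>w j x - m r j x\<bar> powr p + \<bar>m r j x\<bar> powr p)" using p by (intro add_powr_le) auto
      also have "\<dots> \<le> 2 powr p * ((\<integral>y. \<bar>g y\<bar> powr p \<partial>lborel) / V r + \<bar>m r j x\<bar> powr p)"
        using osc_avg by (intro mult_left_mono add_right_mono) auto
      also have "\<dots> = 2 powr p / V r * (\<integral>y. \<bar>g y\<bar> powr p \<partial>lborel) + 2 powr p * \<bar>m r j x\<bar> powr p"
        by (simp add: algebra_simps)
      finally have "ennreal (\<bar>w j x\<bar> powr p)
          \<le> ennreal (2 powr p / V r * (\<integral>y. \<bar>g y\<bar> powr p \<partial>lborel) + 2 powr p * \<bar>m r j x\<bar> powr p)"
        by (rule ennreal_leI)
      also have "\<dots> = ennreal (2 powr p / V r) * osc r j x + ennreal (2 powr p * \<bar>m r j x\<bar> powr p)"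
        using V by (simp add: osc_eq ennreal_mult[symmetric] ennreal_plus)
      finally show ?thesis .
    qed
    have "ennreal (\<integral>x. \<bar>w j x\<bar> powr p \<partial>lborel) = (\<integral>\<^sup>+x. ennreal (\<bar>w j x\<bar> powr p) \<partial>lborel)"
      by (rule nn_integral_eq_integral[symmetric, OF W(2)]) auto
    also have "\<dots> \<le> (\<integral>\<^sup>+x. ennreal (2 powr p / V r) * osc r j x
        + ennreal (2 powr p) * ennreal (indicator (ball 0 R) x * \<bar>m r j x\<bar> powr p) \<partial>lborel)"
    proof (rule nn_integral_mono_AE)
      show "AE x in lborel. ennreal (\<bar>w j x\<bar> powr p) \<le> ennreal (2 powr p / V r) * osc r j x
        + ennreal (2 powr p) * ennreal (indicator (ball 0 R) x * \<bar>m r j x\<bar> powr p)"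
        using W(4)[of j]
      proof eventually_elim
        case (elim x)
        show ?case
        proof (cases "x \<in> \<Omega>")
          case True
          then have "x \<in> ball 0 R" using \<Omega> by auto
          then show ?thesis using pt[of x] by (simp add: ennreal_mult)
        qed (use elim p in simp)
      qed
    qed
    also have "\<dots> = ennreal (2 powr p / V r) * (\<integral>\<^sup>+x. osc r j x \<partial>lborel)
        + ennreal (2 powr p) * (\<integral>\<^sup>+x. ennreal (indicator (ball 0 R) x * \<bar>m r j x\<bar> powr p) \<partial>lborel)"
      by (simp add: nn_integral_add nn_integral_cmult)
    also have "(\<integral>\<^sup>+x. ennreal (indicator (ball 0 R) x * \<bar>m r j x\<bar> powr p) \<partial>lborel) = ennreal (Q r j)"
      unfolding Q_def by (rule nn_integral_eq_integral[OF iQ[OF r]]) auto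
    also have "(\<integral>\<^sup>+x. osc r j x \<partial>lborel) \<le> ennreal (r powr (real DIM('a) + s * p) / c0) * energy p k (w j)"
      unfolding osc_def by (rule local_oscillation_le_energy[OF W(1) r])
    also have "energy p k (w j) \<le> ennreal K"
    proof -
      have "energy p k (w j) = ennreal (enn2real (energy p k (w j)))" using W(3) by (simp add: less_top)
      also have "\<dots> \<le> ennreal K" by (rule ennreal_leI[OF K])
      finally show ?thesis .
    qed
    finally have "ennreal (\<integral>x. \<bar>w j x\<bar> powr p \<partial>lborel)
      \<le> ennreal (2 powr p / V r) * (ennreal (r powr (real DIM('a) + s * p) / c0) * ennreal K) + ennreal (2 powr p) * ennreal (Q r j)"
      by (simp add: mult_left_mono add_right_mono)
    also have "\<dots> = ennreal (2 powr p / V r * (r powr (real DIM('a) + s * p) / c0 * K) + 2 powr p * Q r j)"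
    proof -
      have "0 \<le> Q r j" by (simp add: Q_def)
      then show ?thesis using V c0 K0
        by (simp add: ennreal_mult[symmetric] del: times_divide_eq_left times_divide_eq_right)
    qed
    also have "2 powr p / V r * (r powr (real DIM('a) + s * p) / c0 * K) = D * r powr (s * p)"
      using r by (simp add: V_r[OF r] D_def powr_add)
    finally show ?thesis
      using D by (subst (asm) ennreal_le_iff) (auto simp: Q_def)
  qed
  show ?thesis
  proof (rule LIMSEQ_I)
    fix e :: real assume e: "0 < e"
    \<comment> \<open>Chosen so that \<open>D r^(s p)\<close> is at most \<open>e / 2\<close>.\<close>
    define r where "r = (e / (2 * (D + 1))) powr (1 / (s * p))"
    have q: "0 < e / (2 * (D + 1))" using e D by simp
    have r: "0 < r" using q e D by (simp add: r_def)
    have "r powr (s * p) = e / (2 * (D + 1))" using q e D s p by (simp add: r_def powr_powr)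
    then have "(D + 1) * r powr (s * p) = e / 2" using D by (simp add: field_simps)
    then have "D * r powr (s * p) + r powr (s * p) = e / 2" by (simp add: distrib_right)
    then have Dr: "D * r powr (s * p) \<le> e / 2" using powr_ge_zero[of r "s * p"] by linarith
    have "(\<lambda>j. 2 powr p * Q r j) \<longlonglongrightarrow> 0" by (intro tendsto_mult_right_zero Q_lim r)
    then have "\<forall>\<^sub>F j in sequentially. 2 powr p * Q r j < e / 2" using e by (intro order_tendstoD(2)[where y = 0]) auto
    then have "\<forall>\<^sub>F j in sequentially. norm ((\<integral>x. \<bar>w j x\<bar> powr p \<partial>lborel) - 0) < e"
    proof eventually_elim
      case (elim j)
      have "(\<integral>x. \<bar>w j x\<bar> powr p \<partial>lborel) < e" using main[OF r, of j] Dr elim by linarith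
      then show ?case by simp
    qed
    then show "\<exists>n0. \<forall>n\<ge>n0. norm ((\<integral>x. \<bar>w n x\<bar> powr p \<partial>lborel) - 0) < e"
      by (simp add: eventually_sequentially)
  qed
qed

section \<open>Strong convergence of the solutions\<close>

lemma Bh_eq_kernel_measure:
  fixes u v :: "'a \<Rightarrow> real"
  assumes [measurable]: "u \<in> borel_measurable borel" "v \<in> borel_measurable borel"
      "h \<in> borel_measurable (lborel \<Otimes>\<^sub>M lborel)"
  shows "Bh p k h u v = (\<integral>z. h z * (power_flux p (incr u z) * incr v z) \<partial>kernel_measure p k)"
proof -
  have "(\<integral>z. h z * (power_flux p (incr u z) * incr v z) \<partial>kernel_measure p k)
    = (\<integral>z. kernel_weight p k z *\<^sub>R (h z * (power_flux p (incr u z) * incr v z)) \<partial>(lborel \<Otimes>\<^sub>M lborel))"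
    unfolding kernel_measure_def
    by (rule integral_density) (auto simp: kernel_weight_nonneg)
  also have "\<dots> = Bh p k h u v"
    unfolding Bh_def
    by (rule Bochner_Integration.integral_cong) (auto simp: kernel_weight_def incr_def power_flux_def)
  finally show ?thesis ..
qed

lemma AE_kernel_measureI:
  assumes "AE z in lborel \<Otimes>\<^sub>M lborel. P z"
  shows "AE z :: 'a \<times> 'a in kernel_measure p k. P z"
proof -
  have "(\<lambda>z :: 'a \<times> 'a. ennreal (kernel_weight p k z)) \<in> borel_measurable (lborel \<Otimes>\<^sub>M lborel)"
    by measurable
  moreover have "AE z in lborel \<Otimes>\<^sub>M lborel. 0 < ennreal (kernel_weight p k z) \<longrightarrow> P z"
    using assms by eventually_elim simp
  ultimately show ?thesis unfolding kernel_measure_def by (simp only: AE_density)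
qed

lemma AE_incr_eq_0_if_Lp_eq_0:
  fixes w :: "'a \<Rightarrow> real"
  assumes w: "w \<in> X0_space \<Omega> p k" and zero: "(\<integral>x. \<bar>w x\<bar> powr p \<partial>lborel) = 0"
  shows "AE z in kernel_measure p k. incr w z = 0"
proof -
  note W = X0_spaceD[OF w]
  note W(1) [measurable]
  have "AE x in lborel. \<bar>w x\<bar> powr p = 0"
    using zero integral_nonneg_eq_0_iff_AE[OF W(2)] by simp
  then have ae: "AE x in lborel. w x = 0" by eventually_elim (use p in auto)
  have "AE z in lborel \<Otimes>\<^sub>M (lborel :: 'a measure). incr w z = 0"
  proof (rule lborel_pair.AE_pair_measure)
    show "{z \<in> space (lborel \<Otimes>\<^sub>M lborel). incr w z = 0} \<in> sets (lborel \<Otimes>\<^sub>M lborel)" by measurable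
    show "AE x in lborel. AE y in lborel. incr w (x, y) = 0"
      using ae
    proof eventually_elim
      case (elim x)
      show ?case using ae by eventually_elim (simp add: incr_def elim)
    qed
  qed
  then show ?thesis by (rule AE_kernel_measureI)
qed

text \<open>The energies of \<open>us j\<close> are bounded because testing the equation with \<open>us j\<close> itself yields
  \<open>hmin E(us j) \<le> f(us j)\<close>, and the right-hand side converges. The value \<open>e\<close> is the one taken where the equation is not
  solved.\<close>
lemma strong_convergence_of_solutions:
  fixes \<Omega> :: "'a set" and hs :: "nat \<Rightarrow> 'a \<times> 'a \<Rightarrow> real"
  assumes bdd: "bounded \<Omega>" and hmin: "0 < hmin"
    and hs: "\<And>j. hs j \<in> H_coeffs hmin hmax"
    and f: "f \<in> X0_dual \<Omega> p k"
    and weak: "weakly_converges (X0_space \<Omega> p k) (X0_norm p k) us u"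
    and sol: "\<And>j. us j = e \<or> (\<forall>v\<in>X0_space \<Omega> p k. Bh p k (hs j) (us j) v = f v)"
  shows "strongly_converges (X0_space \<Omega> p k) (X0_norm p k) us u"
proof -
  let ?X = "X0_space \<Omega> p k" and ?\<mu> = "kernel_measure p k :: ('a \<times> 'a) measure"
  note X = X0_spaceD
  define E where "E w = (\<integral>z. \<bar>incr w z\<bar> powr p \<partial>?\<mu>)" for w :: "'a \<Rightarrow> real"
  have E0: "0 \<le> E w" for w by (simp add: E_def)
  have us: "us j \<in> ?X" for j using weak by (simp add: weakly_converges_def)
  have u: "u \<in> ?X" using weak by (simp add: weakly_converges_def)
  have dual_lim: "(\<lambda>j. l (us j)) \<longlonglongrightarrow> l u" if "l \<in> X0_dual \<Omega> p k" for l
    using weak that by (auto simp: weakly_converges_def X0_dual_def)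
  define w where "w j = (\<lambda>x. us j x - u x)" for j
  have w: "w j \<in> ?X" for j unfolding w_def by (rule X0_space_diff(1)[OF us u])
  have h_meas [measurable]: "hs j \<in> borel_measurable (lborel \<Otimes>\<^sub>M lborel)" for j
    using hs by (simp add: H_coeffs_def)
  have h_bd: "AE z in ?\<mu>. hmin \<le> hs j z \<and> hs j z \<le> hmax" for j
  proof (rule AE_kernel_measureI)
    have "AE (x', x) in lborel \<Otimes>\<^sub>M lborel. hs j (x', x) = hs j (x, x') \<and> hmin \<le> hs j (x', x) \<and> hs j (x', x) \<le> hmax"
      using hs[of j] by (simp add: H_coeffs_def)
    then show "AE z in lborel \<Otimes>\<^sub>M lborel. hmin \<le> hs j z \<and> hs j z \<le> hmax"
      by eventually_elim auto
  qed
  have h_abs: "AE z in ?\<mu>. \<bar>hs j z\<bar> \<le> \<bar>hmax\<bar>" for j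
    using h_bd[of j] by eventually_elim (use hmin in auto)
  have meas [measurable]: "us j \<in> borel_measurable borel" "u \<in> borel_measurable borel" "w j \<in> borel_measurable borel" for j
    using X(1)[OF us] X(1)[OF u] X(1)[OF w] by auto
  obtain R0 where "\<forall>x\<in>\<Omega>. norm x \<le> R0" using bdd by (auto simp: bounded_iff)
  then have \<Omega>R: "\<Omega> \<subseteq> ball 0 (\<bar>R0\<bar> + 1)" and R: "0 < \<bar>R0\<bar> + 1" by force+
  have f_lim: "(\<lambda>j. f (us j)) \<longlonglongrightarrow> f u" by (rule dual_lim[OF f])
  obtain F where F: "\<And>j. \<bar>f (us j)\<bar> \<le> F"
  proof -
    have "Bseq (\<lambda>j. f (us j))" using f_lim by (intro convergent_imp_Bseq convergentI)
    then show ?thesis using that by (auto simp: Bseq_def)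
  qed
  define K where "K = max (E e) (F / hmin)"
  have E_us: "E (us j) \<le> K" for j
  proof (cases "us j = e")
    case False
    then have "Bh p k (hs j) (us j) (us j) = f (us j)" using sol us by blast
    moreover have "Bh p k (hs j) (us j) (us j) = (\<integral>z. hs j z * (power_flux p (incr (us j) z) * incr (us j) z) \<partial>?\<mu>)"
      by (rule Bh_eq_kernel_measure) measurable
    moreover have "hmin * E (us j) \<le> (\<integral>z. hs j z * (power_flux p (incr (us j) z) * incr (us j) z) \<partial>?\<mu>)"
    proof -
      have "(\<integral>z. hmin * \<bar>incr (us j) z\<bar> powr p \<partial>?\<mu>) \<le> (\<integral>z. hs j z * (power_flux p (incr (us j) z) * incr (us j) z) \<partial>?\<mu>)"
      proof (rule integral_mono_AE)
        show "integrable ?\<mu> (\<lambda>z. hs j z * (power_flux p (incr (us j) z) * incr (us j) z))"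
          by (rule integrable_power_flux_mult[OF p _ _ _ X(5)[OF us] X(5)[OF us] h_abs]) measurable
        show "AE z in ?\<mu>. hmin * \<bar>incr (us j) z\<bar> powr p \<le> hs j z * (power_flux p (incr (us j) z) * incr (us j) z)"
          using h_bd[of j] by eventually_elim (auto simp: power_flux_mult_self intro: mult_right_mono)
      qed (use X(5)[OF us] in simp)
      then show ?thesis by (simp add: E_def)
    qed
    ultimately have "hmin * E (us j) \<le> F" using F[of j] by linarith
    then have "E (us j) \<le> F / hmin" using hmin by (simp add: field_simps)
    then show ?thesis by (simp add: K_def)
  qed (simp add: K_def)
  have E_w: "E (w j) \<le> 2 powr p * (K + E u)" for j
  proof -
    have "E (w j) \<le> 2 powr p * (E (us j) + E u)"
      unfolding E_def w_def by (rule X0_space_diff(2)[OF us u])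
    also have "\<dots> \<le> 2 powr p * (K + E u)" using E_us by (intro mult_left_mono add_right_mono) auto
    finally show ?thesis .
  qed
  have Lp: "(\<lambda>j. \<integral>x. \<bar>w j x\<bar> powr p \<partial>lborel) \<longlonglongrightarrow> 0"
  proof (rule strong_Lp_convergence[OF \<Omega>R R w])
    show "enn2real (energy p k (w j)) \<le> 2 powr p * (K + E u)" for j
      using E_w[of j] E0 by (simp add: X(6)[OF w] E_def)
    fix x :: 'a and r
    have fin: "emeasure lborel (ball x r) < \<infinity>" by (rule emeasure_bounded_finite) simp
    have int: "set_integrable lborel (ball x r) v" if "v \<in> ?X" for v
      using X(1,2)[OF that] fin by (intro powr_abs_set_integral_le(1)[OF p]) auto
    have "(\<lambda>j. (\<integral>y\<in>ball x r. us j y \<partial>lborel) - (\<integral>y\<in>ball x r. u y \<partial>lborel)) \<longlonglongrightarrow> 0"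
      using dual_lim[OF ball_integral_in_dual[OF \<Omega>R R, of x r]] by (simp add: LIM_zero)
    then show "(\<lambda>j. \<integral>y\<in>ball x r. w j y \<partial>lborel) \<longlonglongrightarrow> 0"
      unfolding w_def using int[OF us] int[OF u] by (simp add: set_integral_diff)
  qed
  define A where "A n = {z :: 'a \<times> 'a. 1 / real (Suc n) \<le> norm (fst z - snd z)}" for n
  have local: "(\<lambda>j. \<integral>z. indicator (A n) z * \<bar>incr (us j) z - incr u z\<bar> powr p \<partial>?\<mu>) \<longlonglongrightarrow> 0" for n
  proof -
    obtain C where C: "\<And>v :: 'a \<Rightarrow> real. v \<in> borel_measurable borel \<Longrightarrow>
      integrable lborel (\<lambda>x. \<bar>v x\<bar> powr p) \<Longrightarrow> integrable ?\<mu> (\<lambda>z. \<bar>incr v z\<bar> powr p) \<Longrightarrow>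
      (\<integral>z. indicator (A n) z * \<bar>incr v z\<bar> powr p \<partial>?\<mu>) \<le> C * (\<integral>x. \<bar>v x\<bar> powr p \<partial>lborel)"
      using far_increments_le[of "1 / real (Suc n)"] unfolding A_def by auto
    have "(\<lambda>j. \<integral>z. indicator (A n) z * \<bar>incr (w j) z\<bar> powr p \<partial>?\<mu>) \<longlonglongrightarrow> 0"
    proof (rule tendsto_sandwich)
      show "\<forall>\<^sub>F j in sequentially. 0 \<le> (\<integral>z. indicator (A n) z * \<bar>incr (w j) z\<bar> powr p \<partial>?\<mu>)" by simp
      show "\<forall>\<^sub>F j in sequentially. (\<integral>z. indicator (A n) z * \<bar>incr (w j) z\<bar> powr p \<partial>?\<mu>)
          \<le> C * (\<integral>x. \<bar>w j x\<bar> powr p \<partial>lborel)"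
        using C[OF X(1)[OF w] X(2)[OF w] X(5)[OF w]] by simp
      show "(\<lambda>j. C * (\<integral>x. \<bar>w j x\<bar> powr p \<partial>lborel)) \<longlonglongrightarrow> 0"
        using tendsto_mult_right_zero[OF Lp] by simp
    qed simp
    then show ?thesis by (simp add: w_def incr_diff)
  qed
  have pairing: "(\<lambda>j. \<integral>z. hs j z * (power_flux p (incr (us j) z) * (incr (us j) z - incr u z)) \<partial>?\<mu>) \<longlonglongrightarrow> 0"
  proof -
    have "\<forall>\<^sub>F j in sequentially. f (us j) - f u
        = (\<integral>z. hs j z * (power_flux p (incr (us j) z) * (incr (us j) z - incr u z)) \<partial>?\<mu>)
      \<or> (\<integral>z. hs j z * (power_flux p (incr (us j) z) * (incr (us j) z - incr u z)) \<partial>?\<mu>) = 0"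
    proof -
      \<comment> \<open>If \<open>d > 0\<close>, the convergence in \<open>L^p\<close> excludes the value \<open>e\<close> for large \<open>j\<close>.\<close>
      define d where "d = (\<integral>x. \<bar>e x - u x\<bar> powr p \<partial>lborel)"
      have "\<forall>\<^sub>F j in sequentially. us j \<noteq> e \<or> d = 0"
      proof (cases "d = 0")
        case False
        then have "0 < d" by (simp add: d_def less_le)
        from order_tendstoD(2)[OF Lp this] show ?thesis
          by eventually_elim (auto simp: w_def d_def)
      qed simp
      then show ?thesis
      proof eventually_elim
        case (elim j)
        show ?case
        proof (cases "us j = e")
          case True
          then have "(\<integral>x. \<bar>w j x\<bar> powr p \<partial>lborel) = 0" using elim by (simp add: d_def w_def)
          then have "AE z in ?\<mu>. incr (w j) z = 0" by (rule AE_incr_eq_0_if_Lp_eq_0[OF w])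
          then have "AE z in ?\<mu>. hs j z * (power_flux p (incr (us j) z) * (incr (us j) z - incr u z)) = 0"
            by eventually_elim (simp add: w_def incr_diff)
          then have "(\<integral>z. hs j z * (power_flux p (incr (us j) z) * (incr (us j) z - incr u z)) \<partial>?\<mu>) = (\<integral>z. 0 \<partial>?\<mu>)"
            by (intro integral_cong_AE) auto
          then show ?thesis by simp
        next
          case False
          then have "Bh p k (hs j) (us j) (us j) = f (us j)" "Bh p k (hs j) (us j) u = f u"
            using sol[of j] us u by blast+
          moreover have "Bh p k (hs j) (us j) v = (\<integral>z. hs j z * (power_flux p (incr (us j) z) * incr v z) \<partial>?\<mu>)"
            if [measurable]: "v \<in> borel_measurable borel" for v
            by (rule Bh_eq_kernel_measure) measurable
          moreover have "integrable ?\<mu> (\<lambda>z. hs j z * (power_flux p (incr (us j) z) * incr v z))" if "v \<in> ?X" for v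
            using X(1)[OF that] by (intro integrable_power_flux_mult[OF p _ _ _ X(5)[OF us] X(5)[OF that] h_abs]) auto
          ultimately show ?thesis using us u by (simp add: right_diff_distrib)
        qed
      qed
    qed
    then have "\<forall>\<^sub>F j in sequentially.
        norm (\<integral>z. hs j z * (power_flux p (incr (us j) z) * (incr (us j) z - incr u z)) \<partial>?\<mu>) \<le> \<bar>f (us j) - f u\<bar>"
      by eventually_elim auto
    moreover have "(\<lambda>j. \<bar>f (us j) - f u\<bar>) \<longlonglongrightarrow> 0"
      using f_lim by (simp add: tendsto_rabs_zero_iff LIM_zero)
    ultimately show ?thesis by (rule Lim_null_comparison)
  qed
  have "(\<lambda>j. \<integral>z. \<bar>incr (us j) z - incr u z\<bar> powr p \<partial>?\<mu>) \<longlonglongrightarrow> 0"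
  proof (rule strong_convergence_of_coercive_pairing[OF p hmin _ _ _ X(5)[OF us] X(5)[OF u] h_bd _ pairing _ _ local])
    show "(\<integral>z. \<bar>incr (us j) z\<bar> powr p \<partial>?\<mu>) \<le> K" for j using E_us by (simp add: E_def)
    show "A n \<in> sets ?\<mu>" for n unfolding A_def by (simp add: far_pairs_measurable del: sets_lborel)
    show "AE z in ?\<mu>. incr u z \<noteq> 0 \<longrightarrow> (\<forall>\<^sub>F n in sequentially. z \<in> A n)"
      unfolding A_def using off_diagonal_eventually_far[of u] by (auto intro!: AE_I2)
  qed measurable
  then have E_lim: "(\<lambda>j. E (w j)) \<longlonglongrightarrow> 0" by (simp add: E_def w_def incr_diff)
  have "(\<lambda>j. E (w j) powr (1 / p)) \<longlonglongrightarrow> 0 powr (1 / p)"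
    using p E0 by (intro tendsto_powr2 E_lim tendsto_const) auto
  then have "(\<lambda>j. X0_norm p k (w j)) \<longlonglongrightarrow> 0"
    by (simp add: X0_norm_def X(6)[OF w] E_def)
  then show ?thesis using us u by (simp add: strongly_converges_def w_def)
qed

end

theorem mainTheorem5:
  fixes \<Omega> :: "'a::euclidean_space set"
    and p s c0 hmin hmax :: real
    and k :: "real \<Rightarrow> real"
    and hs :: "nat \<Rightarrow> 'a \<times> 'a \<Rightarrow> real"
    and h :: "'a \<times> 'a \<Rightarrow> real"
  assumes "smooth_domain \<Omega>" and "bounded \<Omega>"
    and "1 < p" and "0 < s" and "s < 1" and "0 < c0"
    and "admissible_kernel TYPE('a) p s c0 k"
    and "0 < hmin" and "hmin < hmax"
    and "\<And>j. hs j \<in> H_coeffs hmin hmax" and "h \<in> H_coeffs hmin hmax"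
    and "H_converges \<Omega> p k hs h"
  shows "\<forall>f\<in>X0_dual \<Omega> p k.
    strongly_converges (X0_space \<Omega> p k) (X0_norm p k)
      (\<lambda>j. Linv \<Omega> p k (hs j) f) (Linv \<Omega> p k h f)"
proof
  fix f assume f: "f \<in> X0_dual \<Omega> p k"
  show "strongly_converges (X0_space \<Omega> p k) (X0_norm p k)
      (\<lambda>j. Linv \<Omega> p k (hs j) f) (Linv \<Omega> p k h f)"
  proof (rule strong_convergence_of_solutions[OF assms(3,4,6,7,2,8,10) f])
    show "weakly_converges (X0_space \<Omega> p k) (X0_norm p k)
        (\<lambda>j. Linv \<Omega> p k (hs j) f) (Linv \<Omega> p k h f)"
      using assms(12) f by (simp add: H_converges_def)
    \<comment> \<open>Without a solution the predicate of the choice is \<open>\<lambda>u. False\<close>, whatever \<open>j\<close> is.\<close>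
    show "Linv \<Omega> p k (hs j) f = (SOME u. False)
        \<or> (\<forall>v\<in>X0_space \<Omega> p k. Bh p k (hs j) (Linv \<Omega> p k (hs j) f) v = f v)" for j
    proof (cases "\<exists>u. u \<in> X0_space \<Omega> p k \<and> (\<forall>v\<in>X0_space \<Omega> p k. Lop p k (hs j) u v = f v)")
      case True
      from someI_ex[OF this] show ?thesis by (simp add: Linv_def Lop_def)
    next
      case False
      then have "(u \<in> X0_space \<Omega> p k \<and> (\<forall>v\<in>X0_space \<Omega> p k. Lop p k (hs j) u v = f v)) = False" for u
        by blast
      then have "Linv \<Omega> p k (hs j) f = (SOME u. False)" unfolding Linv_def by (simp only:)
      then show ?thesis ..
    qed
  qed
qed

end
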